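(* Let $(M,\omega)$ be a compact finite-dimensional symplectic manifold, $(\Sigma,\sigma)$ a closed connected symplectic $2$-manifold, and $J$ an almost complex structure on $M$. (1) If $J$ is $\omega$-tamed, then the induced almost complex structure $\tilde J$ on the space of immersions $\Sigma\to M$ is $\omega^D_{(\Sigma,\sigma)}$-tamed. (2) If $J$ is $\omega$-compatible, then $\tilde J$ is $\omega^D_{(\Sigma,\sigma)}$-compatible.
   Context: $T_fC^\infty(\Sigma,M)=\Gamma(f^*TM)$, the smooth sections of $f^*TM$. The $2$-form is $(\omega^D_{(\Sigma,\sigma)})_f(\tau_1,\tau_2)=\int_\Sigma\omega_{f(x)}(\tau_1(x),\tau_2(x))\,\sigma$. The induced structure $\tilde J\colon TC^\infty(\Sigma,M)\to TC^\infty(\Sigma,M)$ is $(\tilde J\tau)(x)=J_{f(x)}(\tau(x))$ for $\tau\in\Gamma(f^*TM)$. An almost complex structure $J$ is tamed by a $2$-form $\Omega$ if $\Omega(v,Jv)>0$ for all non-zero tangent vectors $v$; it is $\Omega$-compatible if in addition $\Omega(Jv,Jw)=\Omega(v,w)$ for all tangent vectors $v,w$ at the same point. *)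

theory Defs
  imports "HOL-Analysis.Analysis" "HOL-Library.Function_Algebras"
begin

text \<open>Functions into a real vector space form a real vector space under the pointwise operations
  (addition, negation and zero come from \<open>Function_Algebras\<close>). Tangent vectors and vector fields
  along maps are functions below, and this supplies their linear structure.\<close>

instantiation "fun" :: (type, real_vector) real_vector
begin

definition scaleR_fun :: "real \<Rightarrow> ('a \<Rightarrow> 'b) \<Rightarrow> 'a \<Rightarrow> 'b"
  where "scaleR_fun r f = (\<lambda>x. r *\<^sub>R f x)"

instance
  by standard (auto simp: scaleR_fun_def fun_eq_iff plus_fun_def algebra_simps)

end


section \<open>Smooth maps between Euclidean spaces\<close>

text \<open>Meant for open \<open>U\<close> only.\<close>

primrec Ck_on :: "nat \<Rightarrow> 'a::euclidean_space set \<Rightarrow> ('a \<Rightarrow> 'b::real_normed_vector) \<Rightarrow> bool" where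
  "Ck_on 0 U f \<longleftrightarrow> continuous_on U f"
| "Ck_on (Suc k) U f \<longleftrightarrow> (\<forall>x\<in>U. f differentiable (at x)) \<and>
     (\<forall>v. Ck_on k U (\<lambda>x. frechet_derivative f (at x) v))"

definition smooth_on :: "'a::euclidean_space set \<Rightarrow> ('a \<Rightarrow> 'b::real_normed_vector) \<Rightarrow> bool"
  where "smooth_on U f \<longleftrightarrow> (\<forall>k. Ck_on k U f)"


section \<open>Smooth manifolds\<close>

text \<open>A chart is a pair of its domain and its coordinate map; the values of the coordinate map
  outside the domain carry no information. The manifold is the whole type \<open>'m\<close>, whose Hausdorff and
  second countable topology is the one given by the type classes, and \<open>'e\<close> is the model space.\<close>

type_synonym ('m, 'e) chart = "'m set \<times> ('m \<Rightarrow> 'e)"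

abbreviation chart_dom :: "('m, 'e) chart \<Rightarrow> 'm set" where "chart_dom \<equiv> fst"

abbreviation chart_map :: "('m, 'e) chart \<Rightarrow> 'm \<Rightarrow> 'e" where "chart_map \<equiv> snd"

definition chart_cod :: "('m, 'e) chart \<Rightarrow> 'e set"
  where "chart_cod c = chart_map c ` chart_dom c"

definition chart_inv :: "('m, 'e) chart \<Rightarrow> 'e \<Rightarrow> 'm"
  where "chart_inv c = inv_into (chart_dom c) (chart_map c)"

definition is_chart :: "('m::topological_space, 'e::euclidean_space) chart \<Rightarrow> bool"
  where "is_chart c \<longleftrightarrow> open (chart_dom c) \<and> open (chart_cod c) \<and>
    homeomorphism (chart_dom c) (chart_cod c) (chart_map c) (chart_inv c)"

definition transition :: "('m, 'e) chart \<Rightarrow> ('m, 'e) chart \<Rightarrow> 'e \<Rightarrow> 'e"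
  where "transition c d = chart_map d \<circ> chart_inv c"

definition compatible_charts ::
    "('m, 'e::euclidean_space) chart \<Rightarrow> ('m, 'e) chart \<Rightarrow> bool"
  where "compatible_charts c d \<longleftrightarrow>
    smooth_on (chart_map c ` (chart_dom c \<inter> chart_dom d)) (transition c d) \<and>
    smooth_on (chart_map d ` (chart_dom c \<inter> chart_dom d)) (transition d c)"

text \<open>\<open>M\<close> is a smooth structure, i.e. a maximal smooth atlas.\<close>

definition smooth_manifold ::
    "('m::{t2_space, second_countable_topology}, 'e::euclidean_space) chart set \<Rightarrow> bool"
  where "smooth_manifold M \<longleftrightarrow>
    (\<forall>c\<in>M. is_chart c) \<and>
    (\<Union>c\<in>M. chart_dom c) = UNIV \<and>
    (\<forall>c\<in>M. \<forall>d\<in>M. compatible_charts c d) \<and>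
    (\<forall>c. is_chart c \<and> (\<forall>d\<in>M. compatible_charts c d) \<longrightarrow> c \<in> M)"

definition smooth_function ::
    "('m, 'e::euclidean_space) chart set \<Rightarrow> ('m \<Rightarrow> 'b::real_normed_vector) \<Rightarrow> bool"
  where "smooth_function M g \<longleftrightarrow> (\<forall>c\<in>M. smooth_on (chart_cod c) (g \<circ> chart_inv c))"

definition smooth_map ::
    "('s::topological_space, 'd::euclidean_space) chart set \<Rightarrow>
     ('m::topological_space, 'e::euclidean_space) chart set \<Rightarrow> ('s \<Rightarrow> 'm) \<Rightarrow> bool"
  where "smooth_map S M f \<longleftrightarrow> continuous_on UNIV f \<and>
    (\<forall>c\<in>S. \<forall>d\<in>M. smooth_on (chart_map c ` (chart_dom c \<inter> f -` chart_dom d))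
       (chart_map d \<circ> f \<circ> chart_inv c))"


section \<open>Tangent vectors\<close>

text \<open>A tangent vector at \<open>p\<close> is the family of its components in all charts around \<open>p\<close>, related by
  the derivatives of the transition maps. The component is set to \<open>0\<close> for all other arguments, so
  that tangent vectors at \<open>p\<close> are equal iff their components are.\<close>

type_synonym ('m, 'e) tangent = "('m, 'e) chart \<Rightarrow> 'e"

definition tangent_space ::
    "('m, 'e::euclidean_space) chart set \<Rightarrow> 'm \<Rightarrow> ('m, 'e) tangent set"
  where "tangent_space M p = {v.
    (\<forall>c. \<not> (c \<in> M \<and> p \<in> chart_dom c) \<longrightarrow> v c = 0) \<and>
    (\<forall>c\<in>M. \<forall>d\<in>M. p \<in> chart_dom c \<and> p \<in> chart_dom d \<longrightarrow>
       v d = frechet_derivative (transition c d) (at (chart_map c p)) (v c))}"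

text \<open>The tangent vector at \<open>p\<close> whose component in the chart \<open>c\<close> is \<open>a\<close>.\<close>

definition coord_vector ::
    "('m, 'e::euclidean_space) chart set \<Rightarrow> ('m, 'e) chart \<Rightarrow> 'm \<Rightarrow> 'e \<Rightarrow> ('m, 'e) tangent"
  where "coord_vector M c p a = (\<lambda>d. if d \<in> M \<and> p \<in> chart_dom d
    then frechet_derivative (transition c d) (at (chart_map c p)) a else 0)"

text \<open>The choice of the chart \<open>c\<close> around \<open>x\<close> is immaterial.\<close>

definition differential ::
    "('s, 'd::euclidean_space) chart set \<Rightarrow> ('m, 'e::euclidean_space) chart set \<Rightarrow> ('s \<Rightarrow> 'm) \<Rightarrow>
     's \<Rightarrow> ('s, 'd) tangent \<Rightarrow> ('m, 'e) tangent"
  where "differential S M f x v = (\<lambda>d. if d \<in> M \<and> f x \<in> chart_dom d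
    then (let c = (SOME c. c \<in> S \<and> x \<in> chart_dom c) in
      frechet_derivative (chart_map d \<circ> f \<circ> chart_inv c) (at (chart_map c x)) (v c))
    else 0)"

definition immersions ::
    "('s::topological_space, 'd::euclidean_space) chart set \<Rightarrow>
     ('m::topological_space, 'e::euclidean_space) chart set \<Rightarrow> ('s \<Rightarrow> 'm) set"
  where "immersions S M = {f. smooth_map S M f \<and>
    (\<forall>x. inj_on (differential S M f x) (tangent_space S x))}"

text \<open>The smooth sections of the pullback bundle \<open>f\<^sup>*TM\<close>. For an immersion \<open>f\<close> this is the tangent
  space at \<open>f\<close> of the space of immersions, which is open in the space of smooth maps.\<close>

definition sections_along ::
    "('s, 'd::euclidean_space) chart set \<Rightarrow> ('m, 'e::euclidean_space) chart set \<Rightarrow> ('s \<Rightarrow> 'm) \<Rightarrow>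
     ('s \<Rightarrow> ('m, 'e) tangent) set"
  where "sections_along S M f = {\<tau>. (\<forall>x. \<tau> x \<in> tangent_space M (f x)) \<and>
    (\<forall>c\<in>S. \<forall>d\<in>M. smooth_on (chart_map c ` (chart_dom c \<inter> f -` chart_dom d))
       (\<lambda>y. \<tau> (chart_inv c y) d))}"


section \<open>Linear structures on families of vector spaces\<close>

text \<open>The following notions are stated for a family \<open>T\<close> of vector spaces over a base set \<open>B\<close>, so that
  the same definitions apply to the tangent spaces of a manifold and to those of the space of
  immersions.\<close>

definition alternating_form ::
    "'p set \<Rightarrow> ('p \<Rightarrow> 'v::real_vector set) \<Rightarrow> ('p \<Rightarrow> 'v \<Rightarrow> 'v \<Rightarrow> real) \<Rightarrow> bool"
  where "alternating_form B T \<Omega> \<longleftrightarrow> (\<forall>p\<in>B.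
    (\<forall>u\<in>T p. \<forall>v\<in>T p. \<forall>w\<in>T p. \<forall>a b. \<Omega> p (a *\<^sub>R u + b *\<^sub>R v) w = a * \<Omega> p u w + b * \<Omega> p v w) \<and>
    (\<forall>u\<in>T p. \<forall>v\<in>T p. \<Omega> p u v = - \<Omega> p v u))"

definition complex_structure ::
    "'p set \<Rightarrow> ('p \<Rightarrow> 'v::real_vector set) \<Rightarrow> ('p \<Rightarrow> 'v \<Rightarrow> 'v) \<Rightarrow> bool"
  where "complex_structure B T J \<longleftrightarrow> (\<forall>p\<in>B.
    (\<forall>v\<in>T p. J p v \<in> T p) \<and>
    (\<forall>v\<in>T p. \<forall>w\<in>T p. \<forall>a b. J p (a *\<^sub>R v + b *\<^sub>R w) = a *\<^sub>R J p v + b *\<^sub>R J p w) \<and>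
    (\<forall>v\<in>T p. J p (J p v) = - v))"

definition tamed ::
    "'p set \<Rightarrow> ('p \<Rightarrow> 'v::real_vector set) \<Rightarrow> ('p \<Rightarrow> 'v \<Rightarrow> 'v \<Rightarrow> real) \<Rightarrow> ('p \<Rightarrow> 'v \<Rightarrow> 'v) \<Rightarrow> bool"
  where "tamed B T \<Omega> J \<longleftrightarrow> complex_structure B T J \<and>
    (\<forall>p\<in>B. \<forall>v\<in>T p. v \<noteq> 0 \<longrightarrow> \<Omega> p v (J p v) > 0)"

definition compatible ::
    "'p set \<Rightarrow> ('p \<Rightarrow> 'v::real_vector set) \<Rightarrow> ('p \<Rightarrow> 'v \<Rightarrow> 'v \<Rightarrow> real) \<Rightarrow> ('p \<Rightarrow> 'v \<Rightarrow> 'v) \<Rightarrow> bool"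
  where "compatible B T \<Omega> J \<longleftrightarrow> tamed B T \<Omega> J \<and>
    (\<forall>p\<in>B. \<forall>v\<in>T p. \<forall>w\<in>T p. \<Omega> p (J p v) (J p w) = \<Omega> p v w)"


section \<open>Symplectic forms and almost complex structures\<close>

type_synonym ('m, 'e) two_form = "'m \<Rightarrow> ('m, 'e) tangent \<Rightarrow> ('m, 'e) tangent \<Rightarrow> real"

definition form_in_chart ::
    "('m, 'e::euclidean_space) chart set \<Rightarrow> ('m, 'e) two_form \<Rightarrow> ('m, 'e) chart \<Rightarrow>
     'e \<Rightarrow> 'e \<Rightarrow> 'e \<Rightarrow> real"
  where "form_in_chart M \<omega> c y a b = (let p = chart_inv c y in
    \<omega> p (coord_vector M c p a) (coord_vector M c p b))"

definition smooth_two_form ::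
    "('m, 'e::euclidean_space) chart set \<Rightarrow> ('m, 'e) two_form \<Rightarrow> bool"
  where "smooth_two_form M \<omega> \<longleftrightarrow> alternating_form UNIV (tangent_space M) \<omega> \<and>
    (\<forall>c\<in>M. \<forall>a b. smooth_on (chart_cod c) (\<lambda>y. form_in_chart M \<omega> c y a b))"

text \<open>Evaluated on the (commuting) constant vector fields \<open>u\<close>, \<open>v\<close>, \<open>w\<close> of a chart, the exterior
  derivative of \<open>\<omega>\<close> is the cyclic sum of the directional derivatives \<open>\<partial>\<^sub>u (\<omega>(v, w))\<close>.\<close>

definition closed_two_form ::
    "('m, 'e::euclidean_space) chart set \<Rightarrow> ('m, 'e) two_form \<Rightarrow> bool"
  where "closed_two_form M \<omega> \<longleftrightarrow> (\<forall>c\<in>M. \<forall>y\<in>chart_cod c. \<forall>u v w.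
    frechet_derivative (\<lambda>z. form_in_chart M \<omega> c z v w) (at y) u +
    frechet_derivative (\<lambda>z. form_in_chart M \<omega> c z w u) (at y) v +
    frechet_derivative (\<lambda>z. form_in_chart M \<omega> c z u v) (at y) w = 0)"

definition symplectic_form ::
    "('m, 'e::euclidean_space) chart set \<Rightarrow> ('m, 'e) two_form \<Rightarrow> bool"
  where "symplectic_form M \<omega> \<longleftrightarrow> smooth_two_form M \<omega> \<and> closed_two_form M \<omega> \<and>
    (\<forall>p. \<forall>u\<in>tangent_space M p. u \<noteq> 0 \<longrightarrow> (\<exists>v\<in>tangent_space M p. \<omega> p u v \<noteq> 0))"

definition almost_complex_structure ::
    "('m, 'e::euclidean_space) chart set \<Rightarrow>
     ('m \<Rightarrow> ('m, 'e) tangent \<Rightarrow> ('m, 'e) tangent) \<Rightarrow> bool"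
  where "almost_complex_structure M J \<longleftrightarrow> complex_structure UNIV (tangent_space M) J \<and>
    (\<forall>c\<in>M. \<forall>a. smooth_on (chart_cod c)
       (\<lambda>y. let p = chart_inv c y in J p (coord_vector M c p a) c))"


section \<open>Integration of 2-forms over a compact symplectic surface\<close>

text \<open>The surface is oriented by its symplectic form \<open>\<sigma>\<close>.\<close>

definition positive_chart ::
    "('s, real^2) chart set \<Rightarrow> ('s, real^2) two_form \<Rightarrow> ('s, real^2) chart \<Rightarrow> bool"
  where "positive_chart S \<sigma> c \<longleftrightarrow> c \<in> S \<and>
    (\<forall>y\<in>chart_cod c. form_in_chart S \<sigma> c y (axis 1 1) (axis 2 1) > 0)"

definition oriented_partition ::
    "('s::topological_space, real^2) chart set \<Rightarrow> ('s, real^2) two_form \<Rightarrow>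
     (('s, real^2) chart \<times> ('s \<Rightarrow> real)) set \<Rightarrow> bool"
  where "oriented_partition S \<sigma> P \<longleftrightarrow> finite P \<and>
    (\<forall>(c, \<rho>)\<in>P. positive_chart S \<sigma> c \<and> smooth_function S \<rho> \<and> (\<forall>x. \<rho> x \<ge> 0) \<and>
       closure {x. \<rho> x \<noteq> 0} \<subseteq> chart_dom c) \<and>
    (\<forall>x. (\<Sum>(c, \<rho>)\<in>P. \<rho> x) = 1)"

text \<open>The integral is computed with some finite smooth partition of unity subordinate to positively
  oriented charts; on a compact surface such a partition exists, and for a smooth \<open>\<alpha>\<close> the value does
  not depend on it.\<close>

definition integral_two_form ::
    "('s::topological_space, real^2) chart set \<Rightarrow> ('s, real^2) two_form \<Rightarrow>
     ('s, real^2) two_form \<Rightarrow> real"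
  where "integral_two_form S \<sigma> \<alpha> = (\<Sum>(c, \<rho>)\<in>(SOME P. oriented_partition S \<sigma> P).
    LINT y:chart_cod c|lborel. \<rho> (chart_inv c y) * form_in_chart S \<alpha> c y (axis 1 1) (axis 2 1))"


section \<open>The induced structures on the space of immersions\<close>

definition omega_D ::
    "('s::topological_space, real^2) chart set \<Rightarrow> ('s, real^2) two_form \<Rightarrow>
     ('m, 'e::euclidean_space) two_form \<Rightarrow>
     ('s \<Rightarrow> 'm) \<Rightarrow> ('s \<Rightarrow> ('m, 'e) tangent) \<Rightarrow> ('s \<Rightarrow> ('m, 'e) tangent) \<Rightarrow> real"
  where "omega_D S \<sigma> \<omega> f \<tau>\<^sub>1 \<tau>\<^sub>2 =
    integral_two_form S \<sigma> (\<lambda>x u v. \<omega> (f x) (\<tau>\<^sub>1 x) (\<tau>\<^sub>2 x) * \<sigma> x u v)"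

definition induced_J ::
    "('m \<Rightarrow> ('m, 'e) tangent \<Rightarrow> ('m, 'e) tangent) \<Rightarrow>
     ('s \<Rightarrow> 'm) \<Rightarrow> ('s \<Rightarrow> ('m, 'e) tangent) \<Rightarrow> ('s \<Rightarrow> ('m, 'e) tangent)"
  where "induced_J J f \<tau> = (\<lambda>x. J (f x) (\<tau> x))"

end

theory Submission
  imports Defs
begin

text \<open>Everything holds pointwise except two points. First, \<open>J\<close> has to map smooth sections to smooth
  sections: in a chart, \<open>J\<tau>\<close> is a combination of the smooth columns of \<open>J\<close> along \<open>f\<close> with the
  components of \<open>\<tau>\<close> as coefficients. Second, \<open>\<omega>(\<tau>, J\<tau>)\<close> is a continuous nonnegative function on the
  surface, positive wherever \<open>\<tau> \<noteq> 0\<close>. In a positive chart \<open>\<sigma>\<close> has positive density, so every summand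
  of the integral is nonnegative, and the summand of a member of the partition of unity that is
  nonzero at a point with \<open>\<tau> \<noteq> 0\<close> is positive. As the integral is defined through a chosen
  partition of unity, the existence of one has to be shown: by nondegeneracy every chart becomes
  positive near a given point, possibly after swapping the coordinates, and bump functions built
  from \<open>exp(-1/x)\<close> can be normalised by compactness.\<close>


section \<open>Calculus of smooth maps\<close>

text \<open>The derivative at \<open>x\<close> sees \<open>f\<close> only near \<open>x\<close>, so
  agreement on the open set \<open>U\<close> also makes all derivatives agree there.\<close>

lemma Ck_on_cong:
  assumes "open U" "\<And>x. x \<in> U \<Longrightarrow> f x = g x" "Ck_on k U f"
  shows "Ck_on k U g"
  using assms(2,3)
proof (induction k arbitrary: f g)
  case 0
  then show ?case by (simp cong: continuous_on_cong)
next
  case (Suc k)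
  have g: "(g has_derivative frechet_derivative f (at x)) (at x)" if "x \<in> U" for x
  proof (rule has_derivative_transform_within_open[OF _ assms(1) that])
    show "(f has_derivative frechet_derivative f (at x)) (at x)"
      using Suc.prems(2) that by (simp add: frechet_derivative_works[symmetric])
  qed (use Suc.prems in auto)
  have "Ck_on k U (\<lambda>x. frechet_derivative g (at x) v)" for v
    by (rule Suc.IH[where f = "\<lambda>x. frechet_derivative f (at x) v"])
      (use Suc.prems(2) in \<open>simp_all add: frechet_derivative_at[OF g, symmetric]\<close>)
  then show ?case using g by (auto simp: differentiable_def)
qed

text \<open>Introduction rule for the inductions below: by uniqueness of the derivative, an explicit
  formula \<open>f'\<close> may replace \<open>frechet_derivative\<close>.\<close>

lemma Ck_on_Suc:
  assumes "open U" "\<And>x. x \<in> U \<Longrightarrow> (f has_derivative f' x) (at x)"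
    and "\<And>v. Ck_on k U (\<lambda>x. f' x v)"
  shows "Ck_on (Suc k) U f"
proof -
  have "Ck_on k U (\<lambda>x. frechet_derivative f (at x) v)" for v
    by (rule Ck_on_cong[OF assms(1) _ assms(3)[of v]])
      (simp add: frechet_derivative_at[OF assms(2), symmetric])
  then show ?thesis using assms(2) by (auto simp: differentiable_def)
qed

lemma Ck_on_has_derivative:
  "Ck_on (Suc k) U f \<Longrightarrow> x \<in> U \<Longrightarrow> (f has_derivative frechet_derivative f (at x)) (at x)"
  by (simp add: frechet_derivative_works)

lemma Ck_on_subset: "Ck_on k U f \<Longrightarrow> V \<subseteq> U \<Longrightarrow> Ck_on k V f"
  by (induction k arbitrary: f) (auto intro: continuous_on_subset)

lemma Ck_on_SucD: "Ck_on (Suc k) U f \<Longrightarrow> Ck_on k U f"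
proof (induction k arbitrary: f)
  case 0
  then show ?case
    by (auto intro!: continuous_at_imp_continuous_on differentiable_imp_continuous_within)
next
  case (Suc k)
  then show ?case by (metis Ck_on.simps(2))
qed

text \<open>Continuity on an open set and differentiability at a point are local. This allows
  functions to be glued from smooth pieces.\<close>

lemma Ck_on_local:
  assumes "\<And>x. x \<in> U \<Longrightarrow> \<exists>V. open V \<and> x \<in> V \<and> Ck_on k V f"
  shows "Ck_on k U f"
  using assms
proof (induction k arbitrary: f)
  case 0
  then show ?case
    by (metis Ck_on.simps(1) continuous_at_imp_continuous_on continuous_on_eq_continuous_at)
next
  case (Suc k)
  then show ?case by (metis Ck_on.simps(2))
qed

lemma Ck_on_const: "open U \<Longrightarrow> Ck_on k U (\<lambda>x. a)"
proof (induction k arbitrary: a)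
  case (Suc k)
  show ?case by (rule Ck_on_Suc[where f' = "\<lambda>x v. 0"]) (use Suc in auto)
qed simp

lemma Ck_on_linear_compose:
  assumes "open U" "bounded_linear h"
  shows "Ck_on k U f \<Longrightarrow> Ck_on k U (\<lambda>x. h (f x))"
proof (induction k arbitrary: f)
  case 0
  then show ?case by (simp add: bounded_linear.continuous_on[OF assms(2)])
next
  case (Suc k)
  show ?case
    by (rule Ck_on_Suc[OF assms(1) bounded_linear.has_derivative[OF assms(2)
            Ck_on_has_derivative[OF Suc.prems]]])
      (use Suc in auto)
qed

lemma Ck_on_linear:
  assumes "open U" "bounded_linear h"
  shows "Ck_on k U h"
proof (cases k)
  case 0
  then show ?thesis by (simp add: linear_continuous_on assms)
next
  case (Suc n)
  show ?thesis unfolding Suc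
    by (rule Ck_on_Suc[OF assms(1) bounded_linear.has_derivative[OF assms(2) has_derivative_ident]])
      (use assms in \<open>auto intro: Ck_on_const\<close>)
qed

lemma Ck_on_add:
  assumes "open U"
  shows "Ck_on k U f \<Longrightarrow> Ck_on k U g \<Longrightarrow> Ck_on k U (\<lambda>x. f x + g x)"
proof (induction k arbitrary: f g)
  case 0
  then show ?case by (auto intro: continuous_on_add)
next
  case (Suc k)
  show ?case
    by (rule Ck_on_Suc[OF assms has_derivative_add[OF Ck_on_has_derivative[OF Suc.prems(1)]
            Ck_on_has_derivative[OF Suc.prems(2)]]])
      (use Suc in auto)
qed

lemma Ck_on_sum:
  assumes "open U" "\<And>i. i \<in> I \<Longrightarrow> Ck_on k U (f i)"
  shows "Ck_on k U (\<lambda>x. \<Sum>i\<in>I. f i x)"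
  using assms(2)
  by (induction I rule: infinite_finite_induct)
    (auto intro: Ck_on_const Ck_on_add assms)

text \<open>By the product rule the derivative is a sum of two values of \<open>pr\<close>, each
  pairing one factor with a derivative of the other. The undifferentiated factor is lowered to order
  \<open>k\<close> by \<open>Ck_on_SucD\<close>, and the induction hypothesis applies to both
  terms.\<close>

lemma Ck_on_bilinear:
  fixes f :: "'a::euclidean_space \<Rightarrow> 'b::real_normed_vector"
  assumes "bounded_bilinear pr" "open U"
  shows "Ck_on k U f \<Longrightarrow> Ck_on k U g \<Longrightarrow> Ck_on k U (\<lambda>x. pr (f x) (g x))"
proof (induction k arbitrary: f g)
  case 0
  then show ?case by (simp add: bounded_bilinear.continuous_on[OF assms(1)])
next
  case (Suc k)
  show ?case
    by (rule Ck_on_Suc[OF assms(2) bounded_bilinear.FDERIV[OF assms(1)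
            Ck_on_has_derivative[OF Suc.prems(1)] Ck_on_has_derivative[OF Suc.prems(2)]]])
      (use Suc.prems Suc.IH Ck_on_SucD[OF Suc.prems(1)] Ck_on_SucD[OF Suc.prems(2)] in
        \<open>auto intro!: Ck_on_add assms\<close>)
qed

text \<open>The chain rule evaluates the derivative of \<open>g\<close> in a direction that moves
  with \<open>x\<close>, while \<open>Ck_on\<close> speaks of fixed directions only. Expanding the
  direction in the basis gives \<open>F\<close>, a sum of products to which the induction hypothesis
  applies.\<close>

lemma Ck_on_compose:
  fixes h :: "'a::euclidean_space \<Rightarrow> 'b::euclidean_space"
    and g :: "'b \<Rightarrow> 'c::real_normed_vector"
  assumes "open U" "open V" "h ` U \<subseteq> V"
  shows "Ck_on k U h \<Longrightarrow> Ck_on k V g \<Longrightarrow> Ck_on k U (\<lambda>x. g (h x))"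
proof (induction k arbitrary: g)
  case 0
  then show ?case using assms(3) by (auto intro: continuous_on_compose2)
next
  case (Suc k)
  define F where "F x v = (\<Sum>b\<in>Basis. (frechet_derivative h (at x) v \<bullet> b) *\<^sub>R
    frechet_derivative g (at (h x)) b)" for x v
  have "((\<lambda>x. g (h x)) has_derivative F x) (at x)" if "x \<in> U" for x
  proof -
    have h: "(h has_derivative frechet_derivative h (at x)) (at x)"
      by (rule Ck_on_has_derivative[OF Suc.prems(1) that])
    have g: "(g has_derivative frechet_derivative g (at (h x))) (at (h x))"
      by (rule Ck_on_has_derivative[OF Suc.prems(2)]) (use assms that in auto)
    interpret g: linear "frechet_derivative g (at (h x))"
      using g has_derivative_linear by blast
    have "F x v = frechet_derivative g (at (h x)) (frechet_derivative h (at x) v)" for v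
    proof -
      have "frechet_derivative g (at (h x)) (\<Sum>b\<in>Basis. (frechet_derivative h (at x) v \<bullet> b) *\<^sub>R b)
        = F x v"
        unfolding F_def by (simp add: g.sum g.scale)
      then show ?thesis by (simp add: euclidean_representation)
    qed
    then have "F x = (\<lambda>v. frechet_derivative g (at (h x)) (frechet_derivative h (at x) v))"
      by auto
    then show ?thesis using has_derivative_compose[OF h g] by simp
  qed
  then show ?case
  proof (rule Ck_on_Suc[OF assms(1)])
    have "Ck_on k U (\<lambda>x. frechet_derivative g (at (h x)) b)" for b
      using Suc.prems Ck_on_SucD[OF Suc.prems(1)]
      by (intro Suc.IH[where g = "\<lambda>z. frechet_derivative g (at z) b"]) auto
    then show "Ck_on k U (\<lambda>x. F x v)" for v
      unfolding F_def using Suc.prems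
      by (intro Ck_on_sum assms Ck_on_bilinear[OF bounded_bilinear_scaleR]
          Ck_on_linear_compose[OF _ bounded_linear_inner_left]) auto
  qed
qed

text \<open>The derivative of \<open>inverse\<close> in direction \<open>v\<close> is
  \<open>- (inverse x * v * inverse x)\<close>, a product built from \<open>inverse\<close>
  itself.\<close>

lemma Ck_on_inverse: "Ck_on k {x::real. x \<noteq> 0} inverse"
proof (induction k)
  case 0
  then show ?case by (auto intro!: continuous_intros)
next
  case (Suc k)
  have op: "open {x::real. x \<noteq> 0}" by (simp add: open_Collect_neq)
  show ?case
    by (rule Ck_on_Suc[OF op has_derivative_inverse'])
      (use Suc in \<open>auto intro!: Ck_on_bilinear[OF bounded_bilinear_mult op] Ck_on_const op
        Ck_on_linear_compose[OF op bounded_linear_minus] bounded_linear_ident\<close>)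
qed

section \<open>Closure properties of smooth maps\<close>

lemma smooth_on_cong:
  "open U \<Longrightarrow> (\<And>x. x \<in> U \<Longrightarrow> f x = g x) \<Longrightarrow> smooth_on U f \<Longrightarrow> smooth_on U g"
  unfolding smooth_on_def by (blast intro: Ck_on_cong)

lemma smooth_on_subset: "smooth_on U f \<Longrightarrow> V \<subseteq> U \<Longrightarrow> smooth_on V f"
  unfolding smooth_on_def by (blast intro: Ck_on_subset)

lemma smooth_on_Un:
  assumes "open U" "open V" "smooth_on U f" "smooth_on V f"
  shows "smooth_on (U \<union> V) f"
  unfolding smooth_on_def
  by (intro allI Ck_on_local) (use assms in \<open>auto simp: smooth_on_def\<close>)

lemma smooth_on_const: "open U \<Longrightarrow> smooth_on U (\<lambda>x. a)"
  by (simp add: smooth_on_def Ck_on_const)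

lemma smooth_on_linear: "open U \<Longrightarrow> bounded_linear h \<Longrightarrow> smooth_on U h"
  by (simp add: smooth_on_def Ck_on_linear)

lemma smooth_on_linear_compose:
  "open U \<Longrightarrow> bounded_linear h \<Longrightarrow> smooth_on U f \<Longrightarrow> smooth_on U (\<lambda>x. h (f x))"
  by (simp add: smooth_on_def Ck_on_linear_compose)

lemma smooth_on_sum:
  "open U \<Longrightarrow> (\<And>i. i \<in> I \<Longrightarrow> smooth_on U (f i)) \<Longrightarrow> smooth_on U (\<lambda>x. \<Sum>i\<in>I. f i x)"
  by (simp add: smooth_on_def Ck_on_sum)

lemma smooth_on_diff:
  assumes "open U" "smooth_on U f" "smooth_on U g"
  shows "smooth_on U (\<lambda>x. f x - g x)"
proof -
  have "Ck_on k U (\<lambda>x. f x + - g x)" for k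
    using assms unfolding smooth_on_def
    by (intro Ck_on_add Ck_on_linear_compose[OF _ bounded_linear_minus] bounded_linear_ident) auto
  then show ?thesis by (simp add: smooth_on_def)
qed

lemma smooth_on_bilinear:
  "bounded_bilinear pr \<Longrightarrow> open U \<Longrightarrow> smooth_on U f \<Longrightarrow> smooth_on U g \<Longrightarrow>
    smooth_on U (\<lambda>x. pr (f x) (g x))"
  by (simp add: smooth_on_def Ck_on_bilinear)

lemma smooth_on_compose:
  "open U \<Longrightarrow> open V \<Longrightarrow> h ` U \<subseteq> V \<Longrightarrow> smooth_on U h \<Longrightarrow> smooth_on V g \<Longrightarrow>
    smooth_on U (\<lambda>x. g (h x))"
  unfolding smooth_on_def using Ck_on_compose by blast

lemma smooth_on_imp_continuous_on: "smooth_on U f \<Longrightarrow> continuous_on U f"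
  unfolding smooth_on_def by (metis Ck_on.simps(1))

lemma smooth_on_has_derivative:
  "smooth_on U f \<Longrightarrow> x \<in> U \<Longrightarrow> (f has_derivative frechet_derivative f (at x)) (at x)"
  unfolding smooth_on_def using Ck_on_has_derivative by blast

lemma smooth_on_inverse: "smooth_on {x::real. x \<noteq> 0} inverse"
  by (simp add: smooth_on_def Ck_on_inverse)


section \<open>Bump functions on Euclidean space\<close>

text \<open>The functions \<open>p(1/x) exp(-1/x)\<close>, extended by \<open>0\<close> to \<open>x \<le> 0\<close>, form a class closed under
  differentiation; this is what makes them smooth.\<close>

definition flat :: "real poly \<Rightarrow> real \<Rightarrow> real"
  where "flat p x = (if x > 0 then poly p (1 / x) * exp (- (1 / x)) else 0)"

lemma poly_exp_tendsto_0: "((\<lambda>t. poly p t * exp (- t)) \<longlongrightarrow> (0::real)) at_top"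
proof -
  have *: "((\<lambda>t. t ^ n * exp (- t)) \<longlongrightarrow> (0::real)) at_top" for n
    using tendsto_power_div_exp_0[of n] by (simp add: exp_minus divide_inverse)
  have "((\<lambda>t. \<Sum>i\<le>degree p. coeff p i * (t ^ i * exp (- t))) \<longlongrightarrow> (0::real)) at_top"
    by (auto intro!: tendsto_null_sum tendsto_mult_right_zero *)
  then show ?thesis by (simp add: poly_altdef sum_distrib_right mult.assoc)
qed

text \<open>This is the difference quotient of \<open>flat p\<close> at \<open>0\<close>. With
  \<open>t = 1 / x\<close> the division by \<open>x\<close> multiplies the polynomial by
  \<open>t\<close>, so the quotient is again a polynomial in \<open>t\<close> times
  \<open>exp (- t)\<close>.\<close>

lemma flat_over_tendsto_0: "((\<lambda>x. flat p x / x) \<longlongrightarrow> 0) (at 0)"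
proof (rule filterlim_split_at)
  have "\<forall>\<^sub>F x in at_left 0. flat p x / x = (0::real)"
    by (auto simp: flat_def eventually_at_filter)
  then show "((\<lambda>x. flat p x / x) \<longlongrightarrow> 0) (at_left 0)"
    by (simp add: tendsto_eventually)
  have "((\<lambda>x. poly ([:0, 1:] * p) (1 / x) * exp (- (1 / x))) \<longlongrightarrow> (0::real)) (at_right 0)"
    by (rule filterlim_compose[OF poly_exp_tendsto_0])
      (simp add: filterlim_inverse_at_top_right flip: inverse_eq_divide)
  moreover have "\<forall>\<^sub>F x in at_right 0.
      poly ([:0, 1:] * p) (1 / x) * exp (- (1 / x)) = flat p x / (x::real)"
    by (auto simp: flat_def eventually_at_filter)
  ultimately show "((\<lambda>x. flat p x / x) \<longlongrightarrow> 0) (at_right 0)"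
    by (rule Lim_transform_eventually)
qed

text \<open>With \<open>t = 1 / x\<close>, the derivative of \<open>p(t) exp(-t)\<close> in
  \<open>x\<close> is \<open>- t^2 (p'(t) - p(t)) exp(-t)\<close>; the factor
  \<open>[:0, 0, 1:]\<close> is \<open>t^2\<close>.\<close>

lemma flat_has_derivative:
  "(flat p has_real_derivative flat ([:0, 0, 1:] * (p - pderiv p)) x) (at x)"
proof -
  consider "x > 0" | "x < 0" | "x = 0" by linarith
  then show ?thesis
  proof cases
    case 1
    have "((\<lambda>x. poly p (1 / x) * exp (- (1 / x))) has_real_derivative
        flat ([:0, 0, 1:] * (p - pderiv p)) x) (at x)"
      using 1 by (auto intro!: derivative_eq_intros DERIV_chain2[OF poly_DERIV]
          simp: flat_def field_simps power2_eq_square)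
    then show ?thesis
      by (rule has_field_derivative_transform_within_open[where S = "{0<..}"])
        (use 1 in \<open>auto simp: flat_def\<close>)
  next
    case 2
    have "((\<lambda>x. 0) has_real_derivative flat ([:0, 0, 1:] * (p - pderiv p)) x) (at x)"
      using 2 by (simp add: flat_def)
    then show ?thesis
      by (rule has_field_derivative_transform_within_open[where S = "{..<0}"])
        (use 2 in \<open>auto simp: flat_def\<close>)
  next
    case 3
    then show ?thesis
      using flat_over_tendsto_0[of p] by (simp add: flat_def has_field_derivative_iff)
  qed
qed

lemma smooth_on_flat: "smooth_on UNIV (flat p)"
proof -
  have "Ck_on k UNIV (flat p)" for k
  proof (induction k arbitrary: p)
    case 0
    then show ?case
      using flat_has_derivative by (auto intro: continuous_at_imp_continuous_on DERIV_isCont)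
  next
    case (Suc k)
    show ?case
      by (rule Ck_on_Suc[OF _ flat_has_derivative[unfolded has_field_derivative_def]])
        (auto intro!: Ck_on_bilinear[OF bounded_bilinear_mult] Ck_on_const Suc)
  qed
  then show ?thesis by (simp add: smooth_on_def)
qed

text \<open>\<open>flat 1\<close> is \<open>exp (- 1 / x)\<close> for positive \<open>x\<close>, so
  the bump is positive exactly on the open ball of radius \<open>r\<close> when
  \<open>r > 0\<close>. The squared distance is written as an inner product because that is visibly
  smooth, also at the centre.\<close>

definition bump :: "'a::euclidean_space \<Rightarrow> real \<Rightarrow> 'a \<Rightarrow> real"
  where "bump a r y = flat 1 (r\<^sup>2 - (y - a) \<bullet> (y - a))"

lemma bump_nonneg: "bump a r y \<ge> 0"
  by (simp add: bump_def flat_def)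

lemma bump_nonzero_iff: "r > 0 \<Longrightarrow> bump a r y \<noteq> 0 \<longleftrightarrow> dist y a < r"
  by (auto simp: bump_def flat_def dist_norm simp flip: power2_norm_eq_inner)
    (smt (verit) norm_ge_zero power_less_imp_less_base power2_less_imp_less power_strict_mono pos2)+

lemma smooth_on_bump: "smooth_on UNIV (bump a r)"
proof -
  have id: "smooth_on UNIV (\<lambda>y::'a. y - a)"
    by (intro smooth_on_diff smooth_on_linear smooth_on_const bounded_linear_ident open_UNIV)
  have "smooth_on UNIV (\<lambda>y::'a. r\<^sup>2 - (y - a) \<bullet> (y - a))"
    by (intro smooth_on_diff smooth_on_bilinear[OF bounded_bilinear_inner] id smooth_on_const open_UNIV)
  then show ?thesis
    unfolding bump_def using smooth_on_compose[OF open_UNIV open_UNIV _ _ smooth_on_flat] by force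
qed


section \<open>Charts and tangent vectors\<close>

lemma chart_inv_map: "x \<in> chart_dom c \<Longrightarrow> is_chart c \<Longrightarrow> chart_inv c (chart_map c x) = x"
  unfolding is_chart_def by (meson homeomorphism_apply1)

lemma chart_map_inv: "y \<in> chart_cod c \<Longrightarrow> chart_map c (chart_inv c y) = y"
  unfolding chart_inv_def chart_cod_def by (rule f_inv_into_f)

lemma chart_inv_in_dom: "y \<in> chart_cod c \<Longrightarrow> chart_inv c y \<in> chart_dom c"
  unfolding chart_inv_def chart_cod_def by (rule inv_into_into)

lemma chart_map_in_cod: "x \<in> chart_dom c \<Longrightarrow> chart_map c x \<in> chart_cod c"
  unfolding chart_cod_def by blast

lemma open_chart_dom: "is_chart c \<Longrightarrow> open (chart_dom c)"
  by (simp add: is_chart_def)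

lemma open_chart_cod: "is_chart c \<Longrightarrow> open (chart_cod c)"
  by (simp add: is_chart_def)

lemma continuous_on_chart_map: "is_chart c \<Longrightarrow> continuous_on (chart_dom c) (chart_map c)"
  by (simp add: is_chart_def homeomorphism_def)

lemma continuous_on_chart_inv: "is_chart c \<Longrightarrow> continuous_on (chart_cod c) (chart_inv c)"
  by (simp add: is_chart_def homeomorphism_def)

text \<open>As a preimage under the continuous inverse, the image of an open set is seen to be
  open.\<close>

lemma chart_image_eq_vimage:
  assumes "is_chart c"
  shows "chart_map c ` (chart_dom c \<inter> A) = chart_cod c \<inter> chart_inv c -` A"
  using assms by (force simp: chart_inv_map chart_map_inv chart_inv_in_dom chart_map_in_cod)

lemma open_chart_image:
  assumes "is_chart c" "open A"
  shows "open (chart_map c ` (chart_dom c \<inter> A))"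
  using assms
  by (simp add: chart_image_eq_vimage continuous_open_preimage open_chart_cod continuous_on_chart_inv)

locale manifold =
  fixes M :: "('m::{t2_space, second_countable_topology}, 'e::euclidean_space) chart set"
  assumes smooth_manifold: "smooth_manifold M"
begin

lemma is_chart: "c \<in> M \<Longrightarrow> is_chart c"
  using smooth_manifold by (simp add: smooth_manifold_def)

lemma ex_chart: "\<exists>c\<in>M. p \<in> chart_dom c"
  using smooth_manifold unfolding smooth_manifold_def by blast

lemma smooth_transition:
  "c \<in> M \<Longrightarrow> d \<in> M \<Longrightarrow>
    smooth_on (chart_map c ` (chart_dom c \<inter> chart_dom d)) (transition c d)"
  using smooth_manifold unfolding smooth_manifold_def compatible_charts_def by blast

lemma chart_in_maximal: "is_chart c \<Longrightarrow> (\<And>d. d \<in> M \<Longrightarrow> compatible_charts c d) \<Longrightarrow> c \<in> M"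
  using smooth_manifold unfolding smooth_manifold_def by blast

lemma open_overlap:
  "c \<in> M \<Longrightarrow> d \<in> M \<Longrightarrow> open (chart_map c ` (chart_dom c \<inter> chart_dom d))"
  by (simp add: open_chart_image open_chart_dom is_chart)

lemma transition_apply:
  "c \<in> M \<Longrightarrow> p \<in> chart_dom c \<Longrightarrow> transition c d (chart_map c p) = chart_map d p"
  by (simp add: transition_def chart_inv_map is_chart)

lemma transition_has_derivative:
  assumes "c \<in> M" "d \<in> M" "p \<in> chart_dom c" "p \<in> chart_dom d"
  shows "(transition c d has_derivative
    frechet_derivative (transition c d) (at (chart_map c p))) (at (chart_map c p))"
  by (rule smooth_on_has_derivative[OF smooth_transition]) (use assms in auto)

lemma derivative_transition_self:
  assumes "c \<in> M" "p \<in> chart_dom c"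
  shows "frechet_derivative (transition c c) (at (chart_map c p)) = (\<lambda>a. a)"
proof -
  have "(transition c c has_derivative (\<lambda>a. a)) (at (chart_map c p))"
    by (rule has_derivative_transform_within_open[OF has_derivative_ident open_chart_cod[OF is_chart]])
      (use assms in \<open>auto simp: chart_map_in_cod transition_def chart_map_inv\<close>)
  then show ?thesis by (rule frechet_derivative_at[symmetric])
qed

text \<open>Chain rule: on the overlap of \<open>c\<close> and \<open>d\<close>,
  \<open>transition c e\<close> is \<open>transition d e\<close> after
  \<open>transition c d\<close>. This is what makes \<open>coord_vector\<close> satisfy the
  compatibility condition of \<open>tangent_space\<close>.\<close>

lemma derivative_transition_cocycle:
  assumes "c \<in> M" "d \<in> M" "e \<in> M" "p \<in> chart_dom c" "p \<in> chart_dom d" "p \<in> chart_dom e"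
  shows "frechet_derivative (transition c e) (at (chart_map c p)) a =
    frechet_derivative (transition d e) (at (chart_map d p))
      (frechet_derivative (transition c d) (at (chart_map c p)) a)"
proof -
  have 1: "(transition d e has_derivative frechet_derivative (transition d e) (at (chart_map d p)))
      (at (transition c d (chart_map c p)))"
    using transition_has_derivative[of d e p] assms by (simp add: transition_apply)
  have 2: "(transition c e has_derivative (\<lambda>a. frechet_derivative (transition d e) (at (chart_map d p))
      (frechet_derivative (transition c d) (at (chart_map c p)) a))) (at (chart_map c p))"
    by (rule has_derivative_transform_within_open
        [OF has_derivative_compose[OF transition_has_derivative 1] open_overlap[of c d]])
      (use assms in \<open>auto simp: transition_apply\<close>)
  show ?thesis using frechet_derivative_at[OF 2, symmetric] by simp
qed

lemma coord_vector_self: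
  "c \<in> M \<Longrightarrow> p \<in> chart_dom c \<Longrightarrow> coord_vector M c p a c = a"
  by (simp add: coord_vector_def derivative_transition_self)

lemma coord_vector_tangent:
  "c \<in> M \<Longrightarrow> p \<in> chart_dom c \<Longrightarrow> coord_vector M c p a \<in> tangent_space M p"
  unfolding tangent_space_def coord_vector_def by (auto intro: derivative_transition_cocycle)

text \<open>Together with \<open>coord_vector_self\<close> this identifies the tangent space with
  the model space: one component determines the vector.\<close>

lemma coord_vector_component:
  assumes "c \<in> M" "p \<in> chart_dom c" "v \<in> tangent_space M p"
  shows "coord_vector M c p (v c) = v"
proof
  fix d
  have "v d = frechet_derivative (transition c d) (at (chart_map c p)) (v c)"
    if "d \<in> M" "p \<in> chart_dom d"
    using assms that unfolding tangent_space_def by blast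
  moreover have "v d = 0" if "\<not> (d \<in> M \<and> p \<in> chart_dom d)"
    using assms that unfolding tangent_space_def by blast
  ultimately show "coord_vector M c p (v c) d = v d"
    unfolding coord_vector_def by (metis (full_types))
qed

lemma linear_coord_vector:
  assumes "c \<in> M" "p \<in> chart_dom c"
  shows "linear (coord_vector M c p)"
proof -
  have lin: "linear (frechet_derivative (transition c d) (at (chart_map c p)))"
    if "d \<in> M" "p \<in> chart_dom d" for d
    using transition_has_derivative[OF assms(1) that(1) assms(2) that(2)] has_derivative_linear by blast
  show ?thesis
    by (rule linearI) (auto simp: coord_vector_def fun_eq_iff scaleR_fun_def
        linear_add[OF lin] linear_scale[OF lin])
qed

section \<open>Two-forms and almost complex structures in chart components\<close>

lemma form_in_chart_apply:
  "c \<in> M \<Longrightarrow> p \<in> chart_dom c \<Longrightarrow>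
    form_in_chart M \<omega> c (chart_map c p) a b = \<omega> p (coord_vector M c p a) (coord_vector M c p b)"
  by (simp add: form_in_chart_def chart_inv_map is_chart)

lemma form_antisym:
  assumes "alternating_form UNIV (tangent_space M) \<omega>" "u \<in> tangent_space M p" "v \<in> tangent_space M p"
  shows "\<omega> p u v = - \<omega> p v u"
  using assms unfolding alternating_form_def by blast

lemma linear_form_in_chart_left:
  assumes \<omega>: "alternating_form UNIV (tangent_space M) \<omega>" and c: "c \<in> M" "p \<in> chart_dom c"
  shows "linear (\<lambda>a. form_in_chart M \<omega> c (chart_map c p) a b)"
proof -
  have lin: "\<omega> p (r *\<^sub>R u + s *\<^sub>R v) w = r * \<omega> p u w + s * \<omega> p v w"
    if "u \<in> tangent_space M p" "v \<in> tangent_space M p" "w \<in> tangent_space M p" for u v w r s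
    using \<omega> that unfolding alternating_form_def by blast
  note coord = linear_add[OF linear_coord_vector[OF c]] linear_scale[OF linear_coord_vector[OF c]]
  show ?thesis
    \<comment> \<open>Coefficients \<open>1\<close> and \<open>1\<close> give additivity; second
      coefficient \<open>0\<close> gives homogeneity.\<close>
    using lin[OF coord_vector_tangent[OF c] coord_vector_tangent[OF c] coord_vector_tangent[OF c], of 1 _ 1]
      lin[OF coord_vector_tangent[OF c] coord_vector_tangent[OF c] coord_vector_tangent[OF c], of _ _ 0]
    by (intro linearI) (simp_all add: form_in_chart_apply[OF c] coord)
qed

lemma form_in_chart_antisym:
  assumes "alternating_form UNIV (tangent_space M) \<omega>" "c \<in> M" "p \<in> chart_dom c"
  shows "form_in_chart M \<omega> c (chart_map c p) a b = - form_in_chart M \<omega> c (chart_map c p) b a"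
  using assms by (simp add: form_in_chart_apply)
    (rule form_antisym, simp_all add: coord_vector_tangent)

lemma linear_form_in_chart_right:
  assumes "alternating_form UNIV (tangent_space M) \<omega>" "c \<in> M" "p \<in> chart_dom c"
  shows "linear (form_in_chart M \<omega> c (chart_map c p) a)"
proof -
  have "form_in_chart M \<omega> c (chart_map c p) a = (\<lambda>b. - form_in_chart M \<omega> c (chart_map c p) b a)"
    using form_in_chart_antisym[OF assms] by blast
  then show ?thesis using linear_compose_neg[OF linear_form_in_chart_left[OF assms]] by simp
qed

text \<open>Reduces continuity of a form evaluated on vector fields to that of their components and
  of the chart coefficients of the form.\<close>

lemma form_expand:
  assumes \<omega>: "alternating_form UNIV (tangent_space M) \<omega>" and c: "c \<in> M" "p \<in> chart_dom c"
    and u: "u \<in> tangent_space M p" and v: "v \<in> tangent_space M p"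
  shows "\<omega> p u v = (\<Sum>i\<in>Basis. \<Sum>j\<in>Basis.
    (u c \<bullet> i) * (v c \<bullet> j) * form_in_chart M \<omega> c (chart_map c p) i j)"
proof -
  let ?B = "form_in_chart M \<omega> c (chart_map c p)"
  have right: "?B a b = (\<Sum>j\<in>Basis. (b \<bullet> j) * ?B a j)" for a b
  proof -
    interpret linear "?B a" by (rule linear_form_in_chart_right[OF assms(1-3)])
    have "?B a (\<Sum>j\<in>Basis. (b \<bullet> j) *\<^sub>R j) = (\<Sum>j\<in>Basis. (b \<bullet> j) * ?B a j)"
      by (simp add: sum scale)
    then show ?thesis by (simp add: euclidean_representation)
  qed
  have left: "?B a b = (\<Sum>i\<in>Basis. (a \<bullet> i) * ?B i b)" for a b
  proof -
    interpret linear "\<lambda>a. ?B a b" by (rule linear_form_in_chart_left[OF assms(1-3)])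
    have "?B (\<Sum>i\<in>Basis. (a \<bullet> i) *\<^sub>R i) b = (\<Sum>i\<in>Basis. (a \<bullet> i) * ?B i b)"
      by (simp add: sum scale)
    then show ?thesis by (simp add: euclidean_representation)
  qed
  have "\<omega> p u v = ?B (u c) (v c)"
    by (simp add: form_in_chart_apply c coord_vector_component u v)
  also have "\<dots> = (\<Sum>i\<in>Basis. (u c \<bullet> i) * (\<Sum>j\<in>Basis. (v c \<bullet> j) * ?B i j))"
    by (subst left) (simp add: right[of _ "v c"])
  finally show ?thesis by (simp add: sum_distrib_left mult.assoc)
qed

text \<open>The matrix-vector product in the chart \<open>c\<close>: the summands contain the
  columns of \<open>J\<close>, which are smooth in coordinates for an almost complex
  structure.\<close>

lemma complex_structure_expand:
  assumes J: "complex_structure UNIV (tangent_space M) J" and c: "c \<in> M" "p \<in> chart_dom c"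
    and v: "v \<in> tangent_space M p"
  shows "J p v c = (\<Sum>i\<in>Basis. (v c \<bullet> i) *\<^sub>R J p (coord_vector M c p i) c)"
proof -
  have lin: "J p (r *\<^sub>R u + s *\<^sub>R w) = r *\<^sub>R J p u + s *\<^sub>R J p w"
    if "u \<in> tangent_space M p" "w \<in> tangent_space M p" for u w r s
    using J that unfolding complex_structure_def by blast
  note coord = linear_add[OF linear_coord_vector[OF c]] linear_scale[OF linear_coord_vector[OF c]]
  have "J p (u + w) = J p u + J p w" if "u \<in> tangent_space M p" "w \<in> tangent_space M p" for u w
    using lin[OF that, of 1 1] by simp
  moreover have "J p (r *\<^sub>R u) = r *\<^sub>R J p u" if "u \<in> tangent_space M p" for u r
    using lin[OF that that, of r 0] by simp
  ultimately have "linear (\<lambda>a. J p (coord_vector M c p a) c)"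
    by (intro linearI) (simp_all add: coord coord_vector_tangent c, simp add: scaleR_fun_def)
  then interpret L: linear "\<lambda>a. J p (coord_vector M c p a) c" .
  have "J p v c = J p (coord_vector M c p (\<Sum>i\<in>Basis. (v c \<bullet> i) *\<^sub>R i)) c"
    by (simp add: euclidean_representation coord_vector_component c v)
  then show ?thesis by (simp add: L.sum L.scale)
qed

text \<open>With \<open>L\<close> the identity this restricts a chart, with \<open>L\<close> the coordinate swap it also reverses the
  orientation.\<close>

lemma involuted_subchart:
  fixes L :: "'e \<Rightarrow> 'e"
  assumes c: "c \<in> M" and W: "open W" "W \<subseteq> chart_dom c"
    and L: "linear L" "\<And>a. L (L a) = a"
  defines "c' \<equiv> (W, \<lambda>x. L (chart_map c x))"
  shows "c' \<in> M" and "\<And>p. p \<in> W \<Longrightarrow> chart_inv c' (L (chart_map c p)) = p"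
    and "\<And>p a. p \<in> W \<Longrightarrow> coord_vector M c' p a = coord_vector M c p (L a)"
proof -
  have bl: "bounded_linear L" using L(1) by (simp add: linear_conv_bounded_linear)
  have contL: "continuous_on A L" for A using bl by (rule linear_continuous_on)
  \<comment> \<open>For an involution images are preimages, so openness of images under
    \<open>L\<close> follows from continuity.\<close>
  have imL: "L ` A = L -` A" for A
    by (auto simp: L(2)) (metis L(2) imageI)
  have inj: "inj_on (\<lambda>x. L (chart_map c x)) W"
    by (rule inj_on_inverseI[where g = "\<lambda>y. chart_inv c (L y)"])
      (use W c in \<open>auto simp: L(2) chart_inv_map is_chart\<close>)
  show inv: "chart_inv c' (L (chart_map c p)) = p" if "p \<in> W" for p
    unfolding chart_inv_def c'_def using inv_into_f_f[OF inj that] by simp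
  have cod: "chart_map c' ` (W \<inter> A) = L -` (chart_map c ` (W \<inter> A))" for A
    by (simp add: c'_def flip: imL) (simp add: image_image)
  have opW: "open (chart_map c ` (W \<inter> A))" if "open A" for A
    using open_chart_image[OF is_chart[OF c], of "W \<inter> A"] W that
    by (simp add: Int_absorb1 Int_assoc[symmetric] open_Int)
  have opcod: "open (chart_map c' ` (W \<inter> A))" if "open A" for A
    unfolding cod by (rule open_vimage[OF opW[OF that] contL])
  have inv': "chart_inv c' y = chart_inv c (L y)" if y: "y \<in> chart_map c' ` W" for y
  proof -
    obtain p where p: "p \<in> W" "y = L (chart_map c p)" using y by (auto simp: c'_def)
    have "chart_inv c (L y) = p"
      unfolding p(2) L(2) by (rule chart_inv_map) (use p W c is_chart in auto)
    then show ?thesis unfolding p(2) inv[OF p(1)] by simp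
  qed
  have dom: "chart_dom c' = W" and mp: "chart_map c' = (\<lambda>x. L (chart_map c x))"
    by (simp_all add: c'_def)
  have chart: "is_chart c'"
    unfolding is_chart_def
  proof (intro conjI homeomorphismI)
    show "open (chart_dom c')" "open (chart_cod c')"
      using W opcod[of UNIV] by (simp_all add: dom chart_cod_def)
    show "continuous_on (chart_dom c') (chart_map c')"
      unfolding dom mp
      by (rule continuous_on_compose2[OF contL[of UNIV]
            continuous_on_subset[OF continuous_on_chart_map[OF is_chart[OF c]] W(2)]]) auto
    have "continuous_on (chart_cod c') (\<lambda>y. chart_inv c (L y))"
      by (rule continuous_on_compose2[OF continuous_on_chart_inv[OF is_chart[OF c]] contL])
        (use W in \<open>auto simp: chart_cod_def dom mp L(2)\<close>)
    then show "continuous_on (chart_cod c') (chart_inv c')"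
      by (rule continuous_on_eq) (simp add: inv' chart_cod_def dom)
  qed (auto simp: chart_cod_def dom mp inv)
  have smooth: "smooth_on (chart_map c' ` (W \<inter> chart_dom d)) (transition c' d)" if d: "d \<in> M" for d
  proof -
    have od: "open (chart_dom d)" by (simp add: d is_chart open_chart_dom)
    have "smooth_on (chart_map c' ` (W \<inter> chart_dom d)) (\<lambda>y. transition c d (L y))"
    proof (rule smooth_on_compose[OF opcod[OF od] opW[OF od], where h = L and g = "transition c d"])
      show "smooth_on (chart_map c ` (W \<inter> chart_dom d)) (transition c d)"
        by (rule smooth_on_subset[OF smooth_transition[OF c d]]) (use W in auto)
    qed (auto simp: mp L(2) intro!: smooth_on_linear[OF opcod[OF od, unfolded mp] bl])
    then show ?thesis
      by (rule smooth_on_cong[OF opcod[OF od], rotated])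
        (auto simp: transition_def inv')
  qed
  \<comment> \<open>Here the maximality of the atlas enters: compatibility with all its charts
    suffices.\<close>
  show "c' \<in> M"
  proof (rule chart_in_maximal[OF chart])
    fix d assume d: "d \<in> M"
    have od: "open (chart_map d ` (W \<inter> chart_dom d))"
      using open_chart_image[OF is_chart[OF d] W(1)] by (simp add: Int_commute)
    have "smooth_on (chart_map d ` (W \<inter> chart_dom d)) (\<lambda>y. L (transition d c y))"
      by (rule smooth_on_linear_compose[OF od bl smooth_on_subset[OF smooth_transition[OF d c]]])
        (use W in auto)
    then have "smooth_on (chart_map d ` (W \<inter> chart_dom d)) (transition d c')"
      by (rule smooth_on_cong[OF od, rotated]) (simp add: transition_def mp)
    then show "compatible_charts c' d"
      unfolding compatible_charts_def using smooth[OF d] by (simp add: dom)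
  qed
  show "coord_vector M c' p a = coord_vector M c p (L a)" if p: "p \<in> W" for p a
  proof
    fix d
    have "frechet_derivative (transition c' d) (at (chart_map c' p)) =
        (\<lambda>a. frechet_derivative (transition c d) (at (chart_map c p)) (L a))"
      if d: "d \<in> M" "p \<in> chart_dom d"
    proof (rule frechet_derivative_at[symmetric])
      have 1: "(transition c d has_derivative frechet_derivative (transition c d) (at (chart_map c p)))
          (at (L (chart_map c' p)))"
        using transition_has_derivative[OF c d(1) _ d(2)] p W by (auto simp: mp L(2))
      have op: "open (chart_map c' ` (W \<inter> chart_dom d))"
        by (simp add: d is_chart open_chart_dom opcod)
      show "(transition c' d has_derivative
          (\<lambda>a. frechet_derivative (transition c d) (at (chart_map c p)) (L a))) (at (chart_map c' p))"
        by (rule has_derivative_transform_within_open[OF has_derivative_compose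
              [OF bounded_linear.has_derivative[OF bl has_derivative_ident] 1] op])
          (use p d in \<open>auto simp: transition_def inv'\<close>)
    qed
    then show "coord_vector M c' p a d = coord_vector M c p (L a) d"
      by (simp add: coord_vector_def)
  qed
qed

section \<open>Smooth functions on a manifold\<close>

lemma smooth_function_imp_continuous:
  assumes "smooth_function M g"
  shows "continuous_on UNIV g"
proof -
  have "continuous_on (chart_dom c) g" if c: "c \<in> M" for c
  proof -
    have "continuous_on (chart_dom c) (\<lambda>x. (g \<circ> chart_inv c) (chart_map c x))"
      by (rule continuous_on_compose2[OF smooth_on_imp_continuous_on[of "chart_cod c"]
            continuous_on_chart_map[OF is_chart[OF c]]])
        (use assms c in \<open>auto simp: smooth_function_def chart_map_in_cod comp_def\<close>)
    then show ?thesis by (rule continuous_on_eq) (simp add: chart_inv_map c is_chart)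
  qed
  then have "continuous_on (\<Union>c\<in>M. chart_dom c) g"
    by (intro continuous_on_open_UN) (auto simp: is_chart open_chart_dom)
  then show ?thesis using smooth_manifold by (simp add: smooth_manifold_def)
qed


lemma smooth_function_sum:
  assumes "\<And>i. i \<in> I \<Longrightarrow> smooth_function M (g i)"
  shows "smooth_function M (\<lambda>x. \<Sum>i\<in>I. g i x)"
  unfolding smooth_function_def comp_def
  by (intro ballI smooth_on_sum open_chart_cod is_chart)
    (use assms in \<open>auto simp: smooth_function_def comp_def\<close>)

lemma smooth_function_divide:
  assumes g: "smooth_function M g" and h: "smooth_function M h" and nz: "\<And>x. h x \<noteq> (0::real)"
  shows "smooth_function M (\<lambda>x. g x / h x)"
  unfolding smooth_function_def
proof
  fix c assume c: "c \<in> M"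
  have op: "open (chart_cod c)" by (simp add: c is_chart open_chart_cod)
  have "smooth_on (chart_cod c) (\<lambda>y. inverse ((h \<circ> chart_inv c) y))"
    by (rule smooth_on_compose[OF op _ _ _ smooth_on_inverse])
      (use h c nz in \<open>auto simp: smooth_function_def open_Collect_neq comp_def\<close>)
  moreover have "smooth_on (chart_cod c) (g \<circ> chart_inv c)"
    using g c by (simp add: smooth_function_def)
  ultimately show "smooth_on (chart_cod c) ((\<lambda>x. g x / h x) \<circ> chart_inv c)"
    using smooth_on_bilinear[OF bounded_bilinear_mult op] by (fastforce simp: divide_inverse comp_def)
qed

text \<open>A Euclidean bump is transported by the chart and extended by \<open>0\<close>. The
  closed ball inside the codomain keeps the support in a compact part \<open>K\<close> of the chart
  domain.\<close>

lemma ex_bump_function: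
  assumes c: "c \<in> M" and p: "p \<in> chart_dom c"
  obtains \<beta> :: "'m \<Rightarrow> real" where "smooth_function M \<beta>" "\<And>x. \<beta> x \<ge> 0" "\<beta> p > 0"
    "closure {x. \<beta> x \<noteq> 0} \<subseteq> chart_dom c"
proof -
  obtain e where e: "e > 0" "cball (chart_map c p) e \<subseteq> chart_cod c"
    using open_contains_cball open_chart_cod[OF is_chart[OF c]] chart_map_in_cod[OF p] by blast
  define \<beta> where "\<beta> x = (if x \<in> chart_dom c then bump (chart_map c p) e (chart_map c x) else 0)" for x
  define K where "K = chart_inv c ` cball (chart_map c p) e"
  have "compact K" unfolding K_def
    by (intro compact_continuous_image compact_cball
        continuous_on_subset[OF continuous_on_chart_inv[OF is_chart[OF c]] e(2)])
  \<comment> \<open>Uses the Hausdorff property. It makes the complement of \<open>K\<close> open,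
    so the extension by \<open>0\<close> can be glued.\<close>
  then have clK: "closed K" by (rule compact_imp_closed)
  have Kc: "K \<subseteq> chart_dom c"
    unfolding K_def by (intro image_subsetI chart_inv_in_dom subsetD[OF e(2)])
  have \<beta>0: "\<beta> x = 0" if x: "x \<notin> K" for x
  proof (rule ccontr)
    assume nz: "\<beta> x \<noteq> 0"
    then have "x \<in> chart_dom c" unfolding \<beta>_def by meson
    then have "dist (chart_map c x) (chart_map c p) < e" "chart_inv c (chart_map c x) = x"
      using nz bump_nonzero_iff[OF e(1)] by (auto simp: \<beta>_def chart_inv_map is_chart c)
    then show False using x unfolding K_def
      by (metis imageI dist_commute less_imp_le mem_cball)
  qed
  have "smooth_on (chart_cod d) (\<beta> \<circ> chart_inv d)" if d: "d \<in> M" for d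
  proof -
    \<comment> \<open>On \<open>?U\<close> the bump is seen through the chart \<open>c\<close>, on
      \<open>?V\<close> it vanishes; the two cover the codomain of \<open>d\<close>.\<close>
    let ?U = "chart_map d ` (chart_dom d \<inter> chart_dom c)" and ?V = "chart_map d ` (chart_dom d \<inter> - K)"
    have U: "open ?U" by (simp add: c d open_overlap)
    have V: "open ?V" using open_chart_image[OF is_chart[OF d], of "- K"] clK by auto
    have "smooth_on ?U (\<lambda>y. bump (chart_map c p) e (transition d c y))"
      by (rule smooth_on_compose[OF U open_UNIV _ smooth_transition[OF d c] smooth_on_bump]) auto
    then have 1: "smooth_on ?U (\<beta> \<circ> chart_inv d)"
      by (rule smooth_on_cong[OF U, rotated])
        (auto simp: \<beta>_def transition_def chart_inv_map is_chart d)
    have 2: "smooth_on ?V (\<beta> \<circ> chart_inv d)"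
      by (rule smooth_on_cong[OF V _ smooth_on_const[OF V]])
        (auto simp: \<beta>0 chart_inv_map is_chart d)
    have "?U \<union> ?V = chart_cod d" using Kc by (auto simp: chart_cod_def)
    then show ?thesis using smooth_on_Un[OF U V 1 2] by simp
  qed
  then have "smooth_function M \<beta>" by (simp add: smooth_function_def)
  moreover have "\<beta> x \<ge> 0" for x by (simp add: \<beta>_def bump_nonneg)
  moreover have "\<beta> p > 0"
    using bump_nonzero_iff[OF e(1), of "chart_map c p" "chart_map c p"]
      bump_nonneg[of "chart_map c p" e "chart_map c p"] e(1) p by (simp add: \<beta>_def)
  moreover have "closure {x. \<beta> x \<noteq> 0} \<subseteq> chart_dom c"
    using closure_minimal[OF _ clK, of "{x. \<beta> x \<noteq> 0}"] \<beta>0 Kc by blast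
  ultimately show ?thesis using that by blast
qed

end


section \<open>Integration over a symplectic surface\<close>

text \<open>Compact support makes \<open>F\<close> integrable. If its integral were
  \<open>0\<close>, \<open>F\<close> would vanish almost everywhere, but the set where
  \<open>F\<close> is positive is open and nonempty, hence not negligible.\<close>

lemma integral_pos_of_continuous:
  fixes F :: "'a::euclidean_space \<Rightarrow> real"
  assumes cont: "continuous_on UNIV F" and K: "compact K" "\<And>y. y \<notin> K \<Longrightarrow> F y = 0"
    and nonneg: "\<And>y. F y \<ge> 0" and pos: "F a > 0"
  shows "(LINT y|lborel. F y) > 0"
proof -
  have "integrable lborel (\<lambda>y. indicator K y *\<^sub>R F y)"
    by (rule borel_integrable_compact[OF K(1)]) (rule continuous_on_subset[OF cont], simp)
  moreover have "(\<lambda>y. indicator K y *\<^sub>R F y) = F"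
    using K(2) by (auto simp: fun_eq_iff indicator_def)
  ultimately have int: "integrable lborel F" by simp
  have "(LINT y|lborel. F y) \<noteq> 0"
  proof
    assume "(LINT y|lborel. F y) = 0"
    then have "AE y in lborel. F y = 0" using integral_nonneg_eq_0_iff_AE[OF int] nonneg by simp
    \<comment> \<open>\<open>negligible\<close> refers to Lebesgue measure, the completion of
      \<open>lborel\<close>.\<close>
    then have "AE y in lebesgue. y \<notin> {y. F y > 0}"
      by (intro AE_completion) (auto elim: AE_mp)
    moreover have op: "open {y. F y > 0}" by (intro open_Collect_less continuous_on_const cont)
    ultimately have "negligible {y. F y > 0}"
      by (simp add: negligible_iff_null_sets AE_iff_null_sets)
    then show False using open_not_negligible[OF op] pos by blast
  qed
  moreover have "(LINT y|lborel. F y) \<ge> 0" using nonneg by simp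
  ultimately show ?thesis by simp
qed

locale symplectic_surface = manifold S
  for S :: "('s::{t2_space, second_countable_topology}, real^2) chart set" +
  fixes \<sigma> :: "('s, real^2) two_form"
  assumes symplectic: "symplectic_form S \<sigma>"
begin

lemma alternating_\<sigma>: "alternating_form UNIV (tangent_space S) \<sigma>"
  using symplectic by (simp add: symplectic_form_def smooth_two_form_def)

text \<open>In dimension two, \<open>axis 1 1\<close> always pairs to \<open>0\<close> with itself.
  If it also did so with \<open>axis 2 1\<close>, it would pair to \<open>0\<close> with everything,
  against nondegeneracy.\<close>

lemma area_density_nonzero:
  assumes c: "c \<in> S" "p \<in> chart_dom c"
  shows "form_in_chart S \<sigma> c (chart_map c p) (axis 1 1) (axis 2 1) \<noteq> 0"
proof
  let ?B = "form_in_chart S \<sigma> c (chart_map c p)"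
  assume 0: "?B (axis 1 1) (axis 2 1) = 0"
  let ?u = "coord_vector S c p (axis 1 1)"
  have u: "?u \<in> tangent_space S p" by (rule coord_vector_tangent[OF c])
  have "?u c \<noteq> 0" by (simp add: coord_vector_self c axis_eq_0_iff)
  then have "?u \<noteq> 0" by auto
  then obtain v where v: "v \<in> tangent_space S p" "\<sigma> p ?u v \<noteq> 0"
    using symplectic u unfolding symplectic_form_def by blast
  interpret linear "?B (axis 1 1)" by (rule linear_form_in_chart_right[OF alternating_\<sigma> c])
  have 1: "?B (axis 1 1) (axis 1 1) = 0"
    using form_in_chart_antisym[OF alternating_\<sigma> c, of "axis 1 1" "axis 1 1"] by simp
  have "v c = (v c $ 1) *\<^sub>R axis 1 1 + (v c $ 2) *\<^sub>R axis 2 1"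
    by (simp add: vec_eq_iff forall_2 axis_def)
  then have "?B (axis 1 1) (v c) = 0" using 0 1 by (metis add scale scale_zero_right add_0)
  then show False using v by (simp add: form_in_chart_apply c coord_vector_component)
qed

text \<open>The density is continuous and nonzero, so it keeps its sign near \<open>p\<close>. A
  negative sign is repaired by swapping the coordinates, since the form is antisymmetric.\<close>

lemma ex_positive_chart:
  obtains c where "positive_chart S \<sigma> c" "p \<in> chart_dom c"
proof -
  note positive = that
  obtain c where c: "c \<in> S" "p \<in> chart_dom c" using ex_chart by blast
  define s where "s y = form_in_chart S \<sigma> c y (axis 1 1) (axis 2 1)" for y
  have conts: "continuous_on (chart_cod c) s"
    using symplectic c unfolding symplectic_form_def smooth_two_form_def s_def
    by (blast intro: smooth_on_imp_continuous_on)
  have op: "open (chart_dom c \<inter> (\<lambda>x. s (chart_map c x)) -` B)" if "open B" for B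
    by (rule continuous_open_preimage[OF continuous_on_compose2[OF conts continuous_on_chart_map]])
      (auto simp: c is_chart open_chart_dom chart_map_in_cod that)
  \<comment> \<open>One argument for both signs: \<open>B\<close> will be the half-line containing
    the density at \<open>p\<close>, and \<open>L\<close> the identity or the coordinate
    swap.\<close>
  have *: ?thesis if L: "linear L" "\<And>a. L (L a) = a" and B: "open B" "s (chart_map c p) \<in> B"
    and pos: "\<And>q. q \<in> chart_dom c \<Longrightarrow> s (chart_map c q) \<in> B \<Longrightarrow>
      form_in_chart S \<sigma> c (chart_map c q) (L (axis 1 1)) (L (axis 2 1)) > 0"
  for L :: "real^2 \<Rightarrow> real^2" and B
  proof -
    define W where "W = chart_dom c \<inter> (\<lambda>x. s (chart_map c x)) -` B"
    define c' where "c' = (W, \<lambda>x. L (chart_map c x))"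
    have W: "W \<subseteq> chart_dom c" by (auto simp: W_def)
    note sub = involuted_subchart[OF c(1) op[OF B(1), folded W_def] W L, folded c'_def]
    have "form_in_chart S \<sigma> c' y (axis 1 1) (axis 2 1) > 0" if y: "y \<in> chart_cod c'" for y
    proof -
      obtain q where q: "q \<in> W" "y = L (chart_map c q)"
        using y by (auto simp: chart_cod_def c'_def)
      have "form_in_chart S \<sigma> c' y (axis 1 1) (axis 2 1) =
          form_in_chart S \<sigma> c (chart_map c q) (L (axis 1 1)) (L (axis 2 1))"
        using q W c by (subst form_in_chart_apply)
          (auto simp: form_in_chart_def sub(2) sub(3))
      then show ?thesis using pos[of q] q(1) by (simp add: W_def)
    qed
    then have "positive_chart S \<sigma> c'" using sub(1) by (simp add: positive_chart_def)
    moreover have "p \<in> chart_dom c'" using c B by (simp add: c'_def W_def)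
    ultimately show ?thesis by (rule positive)
  qed
  show ?thesis
  proof (cases "s (chart_map c p) > 0")
    case True
    show ?thesis
      by (rule *[where L = "\<lambda>a. a" and B = "{0<..}"]) (use True in \<open>auto simp: s_def linear_ident\<close>)
  next
    case False
    define L :: "real^2 \<Rightarrow> real^2" where "L a = vector [a $ 2, a $ 1]" for a
    have neg: "s (chart_map c p) < 0"
      using False area_density_nonzero[OF c] by (simp add: s_def)
    have ax: "L (axis 1 1) = axis 2 1" "L (axis 2 1) = axis 1 1"
      by (auto simp: L_def vec_eq_iff forall_2 axis_def)
    show ?thesis
    proof (rule *[where L = L and B = "{..<0}"])
      show "linear L" by (rule linearI) (auto simp: L_def vec_eq_iff forall_2)
      show "L (L a) = a" for a by (auto simp: L_def vec_eq_iff forall_2)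
      show "form_in_chart S \<sigma> c (chart_map c q) (L (axis 1 1)) (L (axis 2 1)) > 0"
        if "q \<in> chart_dom c" "s (chart_map c q) \<in> {..<0}" for q
        using that form_in_chart_antisym[OF alternating_\<sigma> c(1) that(1), of "axis 1 1" "axis 2 1"]
        by (simp add: ax s_def)
    qed (use neg in auto)
  qed
qed

text \<open>Finitely many bump functions in positive charts have a positive sum \<open>t\<close> by
  compactness; dividing each by \<open>t\<close> gives the partition.\<close>

lemma ex_oriented_partition:
  assumes "compact (UNIV :: 's set)"
  shows "\<exists>P. oriented_partition S \<sigma> P"
proof -
  define G where "G = (\<lambda>(c, \<beta>). positive_chart S \<sigma> c \<and> smooth_function S \<beta> \<and> (\<forall>x. \<beta> x \<ge> (0::real)) \<and>
    closure {x. \<beta> x \<noteq> 0} \<subseteq> chart_dom c)"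
  have "\<exists>q. G q \<and> snd q x > 0" for x
  proof -
    obtain c where c: "positive_chart S \<sigma> c" "x \<in> chart_dom c" using ex_positive_chart .
    then have "c \<in> S" by (simp add: positive_chart_def)
    then obtain \<beta> :: "'s \<Rightarrow> real" where "smooth_function S \<beta>" "\<And>x. \<beta> x \<ge> 0" "\<beta> x > 0"
      "closure {x. \<beta> x \<noteq> 0} \<subseteq> chart_dom c"
      using ex_bump_function c(2) by metis
    then show ?thesis using c by (intro exI[of _ "(c, \<beta>)"]) (simp add: G_def)
  qed
  then obtain q where q: "\<And>x. G (q x)" "\<And>x. snd (q x) x > 0" by metis
  have "open {y. snd (q x) y > 0}" for x
  proof -
    have "continuous_on UNIV (snd (q x))"
      using q(1)[of x] by (intro smooth_function_imp_continuous) (auto simp: G_def split: prod.splits)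
    then show ?thesis by (intro open_Collect_less continuous_on_const)
  qed
  moreover have "UNIV \<subseteq> (\<Union>x. {y. snd (q x) y > 0})" using q(2) by blast
  ultimately obtain X where X: "finite X" "UNIV \<subseteq> (\<Union>x\<in>X. {y. snd (q x) y > 0})"
    by (rule compactE_image[OF assms])
  define Q where "Q = q ` X"
  have Q: "finite Q" "\<And>r. r \<in> Q \<Longrightarrow> G r" using X q by (auto simp: Q_def)
  define t where "t x = (\<Sum>r\<in>Q. snd r x)" for x
  have t: "t x > 0" for x
  proof -
    obtain x' where "x' \<in> X" "snd (q x') x > 0" using X by blast
    then have "q x' \<in> Q" "snd (q x') x > 0" by (auto simp: Q_def)
    then show ?thesis
      unfolding t_def using Q by (intro sum_pos2[of _ "q x'"]) (auto simp: G_def split: prod.splits)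
  qed
  have smt: "smooth_function S t"
    unfolding t_def using Q by (intro smooth_function_sum) (auto simp: G_def split: prod.splits)
  define N where "N = (\<lambda>r::('s, real^2) chart \<times> ('s \<Rightarrow> real). (fst r, \<lambda>x. snd r x / t x))"
  \<comment> \<open>A partition is a set of pairs, so distinct members must stay distinct after the
    division for the sum to be reindexed.\<close>
  have inj: "inj_on N Q"
    using t by (intro inj_onI) (auto simp: N_def fun_eq_iff prod_eq_iff less_imp_neq[symmetric])
  have "oriented_partition S \<sigma> (N ` Q)"
    unfolding oriented_partition_def
  proof (intro conjI ballI allI)
    show "finite (N ` Q)" using Q by simp
    show "case r of (c, \<rho>) \<Rightarrow> positive_chart S \<sigma> c \<and> smooth_function S \<rho> \<and> (\<forall>x. \<rho> x \<ge> 0) \<and>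
       closure {x. \<rho> x \<noteq> 0} \<subseteq> chart_dom c" if r: "r \<in> N ` Q" for r
    proof -
      obtain c \<beta> where cb: "r = (c, \<lambda>x. \<beta> x / t x)" "(c, \<beta>) \<in> Q" using r by (auto simp: N_def)
      have g: "positive_chart S \<sigma> c" "smooth_function S \<beta>" "\<And>x. \<beta> x \<ge> 0"
        "closure {x. \<beta> x \<noteq> 0} \<subseteq> chart_dom c"
        using Q(2)[OF cb(2)] by (auto simp: G_def)
      have nz: "t x \<noteq> 0" for x using t[of x] by simp
      show ?thesis using g t nz smooth_function_divide[OF g(2) smt nz]
        by (simp add: cb(1) less_imp_le)
    qed
    show "(\<Sum>(c, \<rho>)\<in>N ` Q. \<rho> x) = 1" for x
    proof -
      have "(\<Sum>(c, \<rho>)\<in>N ` Q. \<rho> x) = (\<Sum>r\<in>Q. snd r x / t x)"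
        by (subst sum.reindex[OF inj]) (simp add: N_def)
      also have "\<dots> = 1" using t[of x] by (simp add: t_def flip: sum_divide_distrib)
      finally show ?thesis .
    qed
  qed
  then show ?thesis by blast
qed

text \<open>Positivity holds for every oriented partition, hence for the chosen one, so independence
  of the choice is not at issue.\<close>

lemma integral_two_form_pos:
  assumes compact: "compact (UNIV :: 's set)"
    and h: "continuous_on UNIV h" "\<And>x. h x \<ge> 0" "h a > 0"
  shows "integral_two_form S \<sigma> (\<lambda>x u v. h x * \<sigma> x u v) > 0"
proof -
  define P where "P = (SOME P. oriented_partition S \<sigma> P)"
  have P: "oriented_partition S \<sigma> P"
    unfolding P_def by (rule someI_ex[OF ex_oriented_partition[OF compact]])
  \<comment> \<open>The integrand extended by \<open>0\<close> to the whole plane, as in the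
    definition of the set integral.\<close>
  define F where "F = (\<lambda>(c, \<rho>) y. indicator (chart_cod c) y *\<^sub>R (\<rho> (chart_inv c y) *
    form_in_chart S (\<lambda>x u v. h x * \<sigma> x u v) c y (axis 1 1) (axis 2 1)))"
  have F: "F (c, \<rho>) y = (if y \<in> chart_cod c then \<rho> (chart_inv c y) *
      (h (chart_inv c y) * form_in_chart S \<sigma> c y (axis 1 1) (axis 2 1)) else 0)" for c \<rho> y
    by (simp add: F_def form_in_chart_def Let_def)
  have nonneg: "F (c, \<rho>) y \<ge> 0" if "(c, \<rho>) \<in> P" for c \<rho> y
  proof -
    have "\<rho> (chart_inv c y) \<ge> 0"
      "y \<in> chart_cod c \<Longrightarrow> form_in_chart S \<sigma> c y (axis 1 1) (axis 2 1) > 0"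
      using P that unfolding oriented_partition_def positive_chart_def by auto
    then show ?thesis using h(2) by (simp add: F less_imp_le)
  qed
  \<comment> \<open>The weights at \<open>a\<close> sum to \<open>1\<close>, so one of them is
    nonzero.\<close>
  obtain c \<rho> where c\<rho>: "(c, \<rho>) \<in> P" "\<rho> a > 0"
  proof -
    have "(\<Sum>r\<in>P. snd r a) = 1"
      using P unfolding oriented_partition_def by (simp add: case_prod_unfold)
    then obtain r where "r \<in> P" "snd r a \<noteq> 0" by (metis sum.neutral zero_neq_one)
    then obtain c \<rho> where r: "(c, \<rho>) \<in> P" "\<rho> a \<noteq> 0" by (metis prod.collapse)
    then have "\<rho> a \<ge> 0" using P unfolding oriented_partition_def by auto
    then show thesis using that[of c \<rho>] r by simp
  qed
  have c: "c \<in> S" "\<And>y. y \<in> chart_cod c \<Longrightarrow> form_in_chart S \<sigma> c y (axis 1 1) (axis 2 1) > 0"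
    and \<rho>: "smooth_function S \<rho>" "closure {x. \<rho> x \<noteq> 0} \<subseteq> chart_dom c"
    using P c\<rho>(1) unfolding oriented_partition_def positive_chart_def by auto
  have "(LINT y|lborel. F (c, \<rho>) y) > 0"
  proof (rule integral_pos_of_continuous)
    define K where "K = chart_map c ` closure {x. \<rho> x \<noteq> 0}"
    have "compact (closure {x. \<rho> x \<noteq> 0})"
      using compact_Int_closed[OF compact, of "closure {x. \<rho> x \<noteq> 0}"] by simp
    then show K: "compact K"
      unfolding K_def
      by (intro compact_continuous_image continuous_on_subset
          [OF continuous_on_chart_map[OF is_chart[OF c(1)]] \<rho>(2)])
    show out: "F (c, \<rho>) y = 0" if y: "y \<notin> K" for y
    proof (cases "y \<in> chart_cod c")
      case True
      then have "\<rho> (chart_inv c y) = 0"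
        using y closure_subset[of "{x. \<rho> x \<noteq> 0}"] unfolding K_def
        by (metis (mono_tags, lifting) chart_map_inv imageI mem_Collect_eq subsetD)
      then show ?thesis by (simp add: F)
    qed (simp add: F)
    have cod: "open (chart_cod c)" by (simp add: c is_chart open_chart_cod)
    have inv: "continuous_on (chart_cod c) (chart_inv c)"
      by (simp add: c is_chart continuous_on_chart_inv)
    have "continuous_on (chart_cod c) (\<lambda>y. \<rho> (chart_inv c y) *
      (h (chart_inv c y) * form_in_chart S \<sigma> c y (axis 1 1) (axis 2 1)))"
    proof (intro continuous_on_mult)
      show "continuous_on (chart_cod c) (\<lambda>y. \<rho> (chart_inv c y))"
        by (rule continuous_on_compose2[OF smooth_function_imp_continuous[OF \<rho>(1)] inv]) simp
      show "continuous_on (chart_cod c) (\<lambda>y. h (chart_inv c y))"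
        by (rule continuous_on_compose2[OF h(1) inv]) simp
      show "continuous_on (chart_cod c) (\<lambda>y. form_in_chart S \<sigma> c y (axis 1 1) (axis 2 1))"
        using symplectic c(1) unfolding symplectic_form_def smooth_two_form_def
        by (blast intro: smooth_on_imp_continuous_on)
    qed
    then have 1: "continuous_on (chart_cod c) (F (c, \<rho>))"
      by (rule continuous_on_eq) (simp add: F)
    have 2: "continuous_on (- K) (F (c, \<rho>))"
      by (rule continuous_on_eq[OF continuous_on_const[of _ 0]]) (simp add: out)
    \<comment> \<open>Continuity on the plane is glued from the codomain of the chart and the
      complement of the compact set \<open>K\<close>, where \<open>F\<close> is
      \<open>0\<close>.\<close>
    have "chart_cod c \<union> - K = UNIV" using \<rho>(2) by (auto simp: K_def chart_cod_def)
    then show "continuous_on UNIV (F (c, \<rho>))"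
      using continuous_on_open_Un[OF cod _ 1 2] K by (auto dest: compact_imp_closed)
    have "a \<in> chart_dom c" using c\<rho>(2) \<rho>(2) closure_subset[of "{x. \<rho> x \<noteq> 0}"] by fastforce
    then show "F (c, \<rho>) (chart_map c a) > 0"
      using c c\<rho>(2) h(3) by (simp add: F chart_map_in_cod chart_inv_map is_chart)
  qed (use nonneg c\<rho>(1) in auto)
  then have "(\<Sum>r\<in>P. LINT y|lborel. F r y) > 0"
    using P c\<rho>(1) nonneg
    by (intro sum_pos2[of P "(c, \<rho>)"]) (auto simp: oriented_partition_def)
  then show ?thesis
    unfolding integral_two_form_def P_def[symmetric]
    by (simp add: F_def set_lebesgue_integral_def case_prod_unfold)
qed

end


section \<open>Sections of the pullback bundle\<close>

text \<open>Near \<open>x\<close>, with a chart \<open>c\<close> around \<open>x\<close> and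
  \<open>d\<close> around \<open>f x\<close>, \<open>form_expand\<close> writes the function as a
  finite sum of products of continuous functions.\<close>

lemma continuous_form_along:
  assumes "manifold S" "manifold M" and f: "continuous_on UNIV f"
    and \<omega>: "smooth_two_form M \<omega>"
    and \<tau>: "\<tau>\<^sub>1 \<in> sections_along S M f" "\<tau>\<^sub>2 \<in> sections_along S M f"
  shows "continuous_on UNIV (\<lambda>x. \<omega> (f x) (\<tau>\<^sub>1 x) (\<tau>\<^sub>2 x))"
proof -
  interpret S: manifold S by fact
  interpret M: manifold M by fact
  have "\<exists>W. open W \<and> x \<in> W \<and> continuous_on W (\<lambda>x. \<omega> (f x) (\<tau>\<^sub>1 x) (\<tau>\<^sub>2 x))" for x
  proof -
    obtain c where c: "c \<in> S" "x \<in> chart_dom c" using S.ex_chart by blast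
    obtain d where d: "d \<in> M" "f x \<in> chart_dom d" using M.ex_chart by blast
    define W where "W = chart_dom c \<inter> f -` chart_dom d"
    have W: "open W" unfolding W_def
      by (intro open_Int open_vimage f open_chart_dom M.is_chart S.is_chart c d)
    have comp: "continuous_on W (\<lambda>x. \<tau> x d)" if \<tau>: "\<tau> \<in> sections_along S M f" for \<tau>
    proof -
      have "continuous_on (chart_map c ` W) (\<lambda>y. \<tau> (chart_inv c y) d)"
        using \<tau> c d unfolding sections_along_def W_def by (blast intro: smooth_on_imp_continuous_on)
      then have "continuous_on W (\<lambda>x. \<tau> (chart_inv c (chart_map c x)) d)"
        by (rule continuous_on_compose2)
          (auto simp: W_def intro: continuous_on_subset[OF continuous_on_chart_map[OF S.is_chart[OF c(1)]]])
      then show ?thesis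
        by (rule continuous_on_eq) (simp add: W_def chart_inv_map S.is_chart c)
    qed
    have "continuous_on W (\<lambda>x. form_in_chart M \<omega> d (chart_map d (f x)) i j)" for i j
    proof (rule continuous_on_compose2[where g = "\<lambda>y. form_in_chart M \<omega> d y i j"])
      show "continuous_on (chart_cod d) (\<lambda>y. form_in_chart M \<omega> d y i j)"
        using \<omega> d(1) unfolding smooth_two_form_def by (blast intro: smooth_on_imp_continuous_on)
      show "continuous_on W (\<lambda>x. chart_map d (f x))"
        by (rule continuous_on_compose2[OF continuous_on_chart_map[OF M.is_chart[OF d(1)]]
              continuous_on_subset[OF f]]) (auto simp: W_def)
    qed (auto simp: W_def chart_map_in_cod)
    then have "continuous_on W (\<lambda>x. \<Sum>i\<in>Basis. \<Sum>j\<in>Basis.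
        (\<tau>\<^sub>1 x d \<bullet> i) * (\<tau>\<^sub>2 x d \<bullet> j) * form_in_chart M \<omega> d (chart_map d (f x)) i j)"
      by (intro continuous_intros comp \<tau>)
    then have "continuous_on W (\<lambda>x. \<omega> (f x) (\<tau>\<^sub>1 x) (\<tau>\<^sub>2 x))"
    proof (rule continuous_on_eq)
      fix x assume "x \<in> W"
      then show "(\<Sum>i\<in>Basis. \<Sum>j\<in>Basis.
        (\<tau>\<^sub>1 x d \<bullet> i) * (\<tau>\<^sub>2 x d \<bullet> j) * form_in_chart M \<omega> d (chart_map d (f x)) i j) =
          \<omega> (f x) (\<tau>\<^sub>1 x) (\<tau>\<^sub>2 x)"
        using \<tau> \<omega> d by (intro M.form_expand[symmetric])
          (auto simp: W_def sections_along_def smooth_two_form_def)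
    qed
    then show ?thesis using W c d by (auto simp: W_def)
  qed
  then show ?thesis
    by (metis continuous_at_imp_continuous_on continuous_on_eq_continuous_at)
qed

text \<open>Pointwise tangency comes from \<open>J\<close>; only smoothness needs an argument, which
  \<open>complex_structure_expand\<close> supplies in charts.\<close>

lemma induced_J_section:
  assumes "manifold S" "manifold M" and f: "smooth_map S M f"
    and J: "almost_complex_structure M J" and \<tau>: "\<tau> \<in> sections_along S M f"
  shows "induced_J J f \<tau> \<in> sections_along S M f"
proof -
  interpret S: manifold S by fact
  interpret M: manifold M by fact
  have cs: "complex_structure UNIV (tangent_space M) J"
    using J by (simp add: almost_complex_structure_def)
  have tan: "\<tau> x \<in> tangent_space M (f x)" for x using \<tau> by (simp add: sections_along_def)
  have "smooth_on (chart_map c ` (chart_dom c \<inter> f -` chart_dom d))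
      (\<lambda>y. J (f (chart_inv c y)) (\<tau> (chart_inv c y)) d)" (is "smooth_on ?U _")
    if c: "c \<in> S" and d: "d \<in> M" for c d
  proof -
    have U: "open ?U"
      using f by (intro open_chart_image S.is_chart c open_vimage open_chart_dom M.is_chart d)
        (simp add: smooth_map_def)
    \<comment> \<open>The \<open>i\<close>-th column of \<open>J\<close> in the chart
      \<open>d\<close>; composing it with the coordinate expression of \<open>f\<close> gives the
      column along \<open>f\<close>.\<close>
    define A where "A i z = J (chart_inv d z) (coord_vector M d (chart_inv d z) i) d" for i z
    have A: "smooth_on (chart_cod d) (A i)" for i
      using J d unfolding almost_complex_structure_def A_def by (simp add: Let_def)
    have f': "smooth_on ?U (chart_map d \<circ> f \<circ> chart_inv c)"
      using f c d by (simp add: smooth_map_def)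
    have "smooth_on ?U (\<lambda>y. A i ((chart_map d \<circ> f \<circ> chart_inv c) y))" for i
      by (rule smooth_on_compose[OF U open_chart_cod[OF M.is_chart[OF d]] _ f' A])
        (auto simp: chart_map_in_cod chart_inv_map S.is_chart c)
    moreover have "smooth_on ?U (\<lambda>y. \<tau> (chart_inv c y) d)"
      using \<tau> c d by (simp add: sections_along_def)
    ultimately have "smooth_on ?U (\<lambda>y. \<Sum>i\<in>Basis.
        (\<tau> (chart_inv c y) d \<bullet> i) *\<^sub>R A i ((chart_map d \<circ> f \<circ> chart_inv c) y))"
      by (intro smooth_on_sum smooth_on_bilinear[OF bounded_bilinear_scaleR] U
          smooth_on_linear_compose[OF U bounded_linear_inner_left])
    then show ?thesis
    proof (rule smooth_on_cong[OF U, rotated])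
      fix y assume "y \<in> ?U"
      then have "f (chart_inv c y) \<in> chart_dom d" by (auto simp: chart_inv_map S.is_chart c)
      then show "(\<Sum>i\<in>Basis.
        (\<tau> (chart_inv c y) d \<bullet> i) *\<^sub>R A i ((chart_map d \<circ> f \<circ> chart_inv c) y)) =
        J (f (chart_inv c y)) (\<tau> (chart_inv c y)) d"
        by (simp add: M.complex_structure_expand[OF cs d _ tan] A_def chart_inv_map M.is_chart d)
    qed
  qed
  then show ?thesis
    using cs tan unfolding sections_along_def induced_J_def complex_structure_def by auto
qed

section \<open>Taming and compatibility of the induced structure\<close>

theorem lemmaA4:
  fixes M :: "('m::{t2_space, second_countable_topology}, 'e::euclidean_space) chart set"
    and \<omega> :: "('m, 'e) two_form"
    and S :: "('s::{t2_space, second_countable_topology}, real^2) chart set"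
    and \<sigma> :: "('s, real^2) two_form"
    and J :: "'m \<Rightarrow> ('m, 'e) tangent \<Rightarrow> ('m, 'e) tangent"
  assumes "smooth_manifold M" and "compact (UNIV :: 'm set)" and "symplectic_form M \<omega>"
    and "smooth_manifold S" and "compact (UNIV :: 's set)" and "connected (UNIV :: 's set)"
    and "symplectic_form S \<sigma>"
    and "almost_complex_structure M J"
  shows "(tamed UNIV (tangent_space M) \<omega> J \<longrightarrow>
      tamed (immersions S M) (sections_along S M) (omega_D S \<sigma> \<omega>) (induced_J J)) \<and>
    (compatible UNIV (tangent_space M) \<omega> J \<longrightarrow>
      compatible (immersions S M) (sections_along S M) (omega_D S \<sigma> \<omega>) (induced_J J))"
proof -
  interpret M: manifold M by standard fact
  interpret S: symplectic_surface S \<sigma> by standard fact+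
  have \<omega>: "smooth_two_form M \<omega>" using assms(3) by (simp add: symplectic_form_def)
  have tan: "\<tau> x \<in> tangent_space M (f x)" if "\<tau> \<in> sections_along S M f" for f \<tau> x
    using that by (simp add: sections_along_def)
  have cs: "complex_structure UNIV (tangent_space M) J"
    using assms(8) by (simp add: almost_complex_structure_def)
  have sec: "induced_J J f \<tau> \<in> sections_along S M f"
    if "f \<in> immersions S M" "\<tau> \<in> sections_along S M f" for f \<tau>
    using that by (intro induced_J_section[OF S.manifold_axioms M.manifold_axioms _ assms(8)])
      (auto simp: immersions_def)
  have "complex_structure (immersions S M) (sections_along S M) (induced_J J)"
    unfolding complex_structure_def
  proof (intro ballI conjI allI)
    fix f \<tau>\<^sub>1 \<tau>\<^sub>2 and a b :: real
    assume f: "f \<in> immersions S M" and \<tau>: "\<tau>\<^sub>1 \<in> sections_along S M f"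
    show "induced_J J f \<tau>\<^sub>1 \<in> sections_along S M f" by (rule sec[OF f \<tau>])
    show "induced_J J f (induced_J J f \<tau>\<^sub>1) = - \<tau>\<^sub>1"
      using cs tan[OF \<tau>] by (simp add: induced_J_def complex_structure_def fun_eq_iff)
    assume "\<tau>\<^sub>2 \<in> sections_along S M f"
    with \<tau> have "\<tau>\<^sub>1 x \<in> tangent_space M (f x)" "\<tau>\<^sub>2 x \<in> tangent_space M (f x)" for x
      by (auto intro: tan)
    then have "J (f x) (a *\<^sub>R \<tau>\<^sub>1 x + b *\<^sub>R \<tau>\<^sub>2 x) =
        a *\<^sub>R J (f x) (\<tau>\<^sub>1 x) + b *\<^sub>R J (f x) (\<tau>\<^sub>2 x)" for x
      using cs unfolding complex_structure_def by blast
    then show "induced_J J f (a *\<^sub>R \<tau>\<^sub>1 + b *\<^sub>R \<tau>\<^sub>2) = a *\<^sub>R induced_J J f \<tau>\<^sub>1 + b *\<^sub>R induced_J J f \<tau>\<^sub>2"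
      by (intro ext[where f = "induced_J J f _"])
        (simp only: induced_J_def plus_fun_def scaleR_fun_def)
  qed
  moreover have "omega_D S \<sigma> \<omega> f \<tau> (induced_J J f \<tau>) > 0"
    if tamed: "tamed UNIV (tangent_space M) \<omega> J"
      and f: "f \<in> immersions S M" and \<tau>: "\<tau> \<in> sections_along S M f" "\<tau> \<noteq> 0" for f \<tau>
  proof -
    have pos: "\<omega> (f x) (\<tau> x) (J (f x) (\<tau> x)) > 0" if "\<tau> x \<noteq> 0" for x
      using tamed that tan[OF \<tau>(1)] by (simp add: tamed_def)
    \<comment> \<open>Tamedness says nothing at points where \<open>\<tau>\<close> vanishes; there
      bilinearity with coefficients \<open>0\<close> gives the value \<open>0\<close>.\<close>
    have zero: "\<omega> (f x) 0 w = 0" if "w \<in> tangent_space M (f x)" for x w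
    proof -
      have "\<omega> (f x) (0 *\<^sub>R w + 0 *\<^sub>R w) w = 0 * \<omega> (f x) w w + 0 * \<omega> (f x) w w"
        using \<omega> that unfolding smooth_two_form_def alternating_form_def by blast
      then show ?thesis by simp
    qed
    have J\<tau>: "induced_J J f \<tau> \<in> sections_along S M f" by (rule sec[OF f \<tau>(1)])
    obtain a where "\<tau> a \<noteq> 0" using \<tau>(2) by (auto simp: fun_eq_iff)
    have nonneg: "\<omega> (f x) (\<tau> x) (induced_J J f \<tau> x) \<ge> 0" for x
      using pos[of x] zero[OF tan[OF J\<tau>, of x]] unfolding induced_J_def
      by (metis less_imp_le order_refl)
    have "continuous_on UNIV f" using f by (simp add: immersions_def smooth_map_def)
    then have "continuous_on UNIV (\<lambda>x. \<omega> (f x) (\<tau> x) (induced_J J f \<tau> x))"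
      by (rule continuous_form_along[OF S.manifold_axioms M.manifold_axioms _ \<omega> \<tau>(1) J\<tau>])
    then show ?thesis
      unfolding omega_D_def
      by (rule S.integral_two_form_pos[OF assms(5) _ nonneg])
        (use pos[OF \<open>\<tau> a \<noteq> 0\<close>] in \<open>simp add: induced_J_def\<close>)
  qed
  \<comment> \<open>Compatibility of \<open>J\<close> at each \<open>f x\<close> makes the two
    integrated forms identical, so no property of the integral is involved.\<close>
  moreover have "omega_D S \<sigma> \<omega> f (induced_J J f \<tau>\<^sub>1) (induced_J J f \<tau>\<^sub>2) = omega_D S \<sigma> \<omega> f \<tau>\<^sub>1 \<tau>\<^sub>2"
    if "compatible UNIV (tangent_space M) \<omega> J"
      and "\<tau>\<^sub>1 \<in> sections_along S M f" "\<tau>\<^sub>2 \<in> sections_along S M f" for f \<tau>\<^sub>1 \<tau>\<^sub>2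
    using that(1) tan[OF that(2)] tan[OF that(3)]
    by (simp add: omega_D_def induced_J_def compatible_def)
  ultimately show ?thesis by (simp add: tamed_def compatible_def)
qed

end
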